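(* Let $\mathcal{C}$ be a covering of $\mathbb{R}^2$ by complete folding curves. Then $\mathcal{C}$ satisfies the local isomorphism property if and only if all the curves of $\mathcal{C}$ have the same type, satisfy $E_k(C)=E_k(C')$ for all $C,C'\in\mathcal{C}$ and all $k\in\mathbb{N}$, and have pairwise locally isomorphic associated sequences.
   Context: All sequences take values in $\{+1,-1\}$. For $S=(a_1,\dots,a_n)$ write $\overline{S}=(-a_n,\dots,-a_1)$. The $n$-folding sequences are defined recursively: the only $0$-folding sequence is the empty sequence, and the $(n+1)$-folding sequences are exactly $(\overline{S},+1,S)$ and $(\overline{S},-1,S)$ with $S$ an $n$-folding sequence. A subword of a sequence $(b_k)$ is a block $(b_{h+1},\dots,b_{h+m})$. A complete folding sequence is a sequence $(a_k)_{k\in\mathbb{Z}}$ each finite subword of which is a subword of some $n$-folding sequence. Two sequences indexed by $\mathbb{Z}$ are locally isomorphic if they have the same finite subwords. For a complete folding sequence $S=(a_h)$ and each $n\in\mathbb{N}$ there is $h_n$ with $a_{h_n+k2^{n+1}}=(-1)^k a_{h_n}$ for all $k\in\mathbb{Z}$; the set $E_n(S)=h_n+2^n\mathbb{Z}$ does not depend on the choice of $h_n$. A segment is an oriented unit edge of $\mathbb{Z}^2$. A complete curve is a sequence $C=(C_i)_{i\in\mathbb{Z}}$ of segments such that the terminal point of $C_i$ is the initial point of $C_{i+1}$, consecutive supports are perpendicular, and all supports are pairwise distinct (curves differing by an index shift are identified). Its associated sequence is $(\eta_i)_{i\in\mathbb{Z}}$ with $\eta_i=+1$ (resp. $-1$)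 if one turns left (resp. right) from $C_i$ to $C_{i+1}$. A complete folding curve is a complete curve whose associated sequence $S$ is a complete folding sequence; it has type $H$ (resp. $V$) if all segments $C_i$ with $i\in E_1(S)$ have horizontal (resp. vertical) supports. Let $\Lambda_{2k}=2^k\mathbb{Z}^2$, $\Lambda_{2k+1}=\mathbb{Z}(2^k,2^k)+\mathbb{Z}(2^k,-2^k)$; $E_n(C)=X+\Lambda_n$ where $X$ is the terminal point of any $C_i$ with $i\in E_n(S)$ (independent of $i$). A covering of $\mathbb{R}^2$ by complete folding curves is a set $\mathcal{C}$ of complete folding curves such that every unit edge of $\mathbb{Z}^2$ is the support of exactly one segment of exactly one curve of $\mathcal{C}$. A decorated segment of $\mathcal{C}$ is a segment of a curve of $\mathcal{C}$ together with, at each endpoint, the support of the segment of the same curve which precedes/follows it there. $\mathcal{C}$ satisfies the local isomorphism property if for every finite set $F$ of decorated segments of $\mathcal{C}$ there is $r>0$ such that every disk of radius $r$ contains a translate $v+F$ ($v\in\mathbb{Z}^2$) which is a set of decorated segments of $\mathcal{C}$. *)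

theory Defs
  imports "HOL-Analysis.Analysis" "HOL-Library.Sublist"
begin

subsection \<open>Folding sequences\<close>

definition bar :: "int list \<Rightarrow> int list" where
  "bar S = map uminus (rev S)"

inductive folding :: "nat \<Rightarrow> int list \<Rightarrow> bool" where
  folding_0: "folding 0 []"
| folding_pos: "folding n S \<Longrightarrow> folding (Suc n) (bar S @ [1] @ S)"
| folding_neg: "folding n S \<Longrightarrow> folding (Suc n) (bar S @ [-1] @ S)"

definition subwords :: "(int \<Rightarrow> int) \<Rightarrow> int list set" where
  "subwords a = {map (\<lambda>j. a (h + int j)) [1..<Suc m] | h m. True}"

definition complete_folding_seq :: "(int \<Rightarrow> int) \<Rightarrow> bool" where
  "complete_folding_seq a \<longleftrightarrow> (\<forall>w\<in>subwords a. \<exists>n S. folding n S \<and> sublist w S)"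

definition locally_isomorphic :: "(int \<Rightarrow> int) \<Rightarrow> (int \<Rightarrow> int) \<Rightarrow> bool" where
  "locally_isomorphic a b \<longleftrightarrow> subwords a = subwords b"

definition alternates_at :: "nat \<Rightarrow> (int \<Rightarrow> int) \<Rightarrow> int \<Rightarrow> bool" where
  "alternates_at n a h \<longleftrightarrow> (\<forall>k. a (h + k * 2 ^ (n + 1)) = (if even k then a h else - a h))"

text \<open>For a complete folding sequence an admissible \<open>h\<close> exists and the resulting coset
  does not depend on which one is chosen.\<close>

definition E_seq :: "nat \<Rightarrow> (int \<Rightarrow> int) \<Rightarrow> int set" where
  "E_seq n a = (let h = (SOME h. alternates_at n a h) in {h + k * 2 ^ n | k. True})"


subsection \<open>Segments and curves\<close>

type_synonym point = "int \<times> int"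

text \<open>A segment is the pair of its initial and its terminal point. A unit edge of the grid
  (the support of a segment) is represented by the set of its two endpoints.\<close>

type_synonym segment = "point \<times> point"
type_synonym edge = "point set"

definition dir :: "segment \<Rightarrow> point" where
  "dir s = snd s - fst s"

definition is_segment :: "segment \<Rightarrow> bool" where
  "is_segment s \<longleftrightarrow> dir s \<in> {(1, 0), (-1, 0), (0, 1), (0, -1)}"

definition support :: "segment \<Rightarrow> edge" where
  "support s = {fst s, snd s}"

definition unit_edges :: "edge set" where
  "unit_edges = {support s | s. is_segment s}"

definition horizontal :: "segment \<Rightarrow> bool" where
  "horizontal s \<longleftrightarrow> snd (dir s) = 0"

definition vertical :: "segment \<Rightarrow> bool" where
  "vertical s \<longleftrightarrow> fst (dir s) = 0"

definition perpendicular :: "segment \<Rightarrow> segment \<Rightarrow> bool" where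
  "perpendicular s t \<longleftrightarrow> fst (dir s) * fst (dir t) + snd (dir s) * snd (dir t) = 0"

definition left_turn :: "segment \<Rightarrow> segment \<Rightarrow> bool" where
  "left_turn s t \<longleftrightarrow> fst (dir s) * snd (dir t) - snd (dir s) * fst (dir t) > 0"

definition complete_curve :: "(int \<Rightarrow> segment) \<Rightarrow> bool" where
  "complete_curve C \<longleftrightarrow>
     (\<forall>i. is_segment (C i)) \<and>
     (\<forall>i. snd (C i) = fst (C (i + 1))) \<and>
     (\<forall>i. perpendicular (C i) (C (i + 1))) \<and>
     (\<forall>i j. i \<noteq> j \<longrightarrow> support (C i) \<noteq> support (C j))"

definition same_curve :: "(int \<Rightarrow> segment) \<Rightarrow> (int \<Rightarrow> segment) \<Rightarrow> bool" where
  "same_curve C D \<longleftrightarrow> (\<exists>m. \<forall>i. D i = C (i + m))"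

definition assoc_seq :: "(int \<Rightarrow> segment) \<Rightarrow> int \<Rightarrow> int" where
  "assoc_seq C i = (if left_turn (C i) (C (i + 1)) then 1 else -1)"

definition complete_folding_curve :: "(int \<Rightarrow> segment) \<Rightarrow> bool" where
  "complete_folding_curve C \<longleftrightarrow> complete_curve C \<and> complete_folding_seq (assoc_seq C)"

definition type_H :: "(int \<Rightarrow> segment) \<Rightarrow> bool" where
  "type_H C \<longleftrightarrow> (\<forall>i\<in>E_seq 1 (assoc_seq C). horizontal (C i))"

definition type_V :: "(int \<Rightarrow> segment) \<Rightarrow> bool" where
  "type_V C \<longleftrightarrow> (\<forall>i\<in>E_seq 1 (assoc_seq C). vertical (C i))"

definition Lam :: "nat \<Rightarrow> point set" where
  "Lam n = (let c = 2 ^ (n div 2) in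
     if even n then {(c * x, c * y) | x y. True}
     else {(x * c + y * c, x * c - y * c) | x y. True})"

text \<open>As for \<open>E_seq\<close>, the result does not depend on the chosen index \<open>i\<close>.\<close>

definition E_curve :: "nat \<Rightarrow> (int \<Rightarrow> segment) \<Rightarrow> point set" where
  "E_curve n C = (let i = (SOME i. i \<in> E_seq n (assoc_seq C)) in {snd (C i) + l | l. l \<in> Lam n})"


subsection \<open>Coverings\<close>

text \<open>A set of curves is given by a set of parametrizations; two parametrizations that differ
  by an index shift are the same curve, so that ``exactly one curve'' means uniqueness up
  to \<open>same_curve\<close>.\<close>

definition covering :: "(int \<Rightarrow> segment) set \<Rightarrow> bool" where
  "covering \<C> \<longleftrightarrow>
     (\<forall>C\<in>\<C>. complete_folding_curve C) \<and>
     (\<forall>e\<in>unit_edges. \<exists>C\<in>\<C>. (\<exists>!i. support (C i) = e) \<and>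
        (\<forall>D\<in>\<C>. (\<exists>i. support (D i) = e) \<longrightarrow> same_curve C D))"

text \<open>A segment with the support of its predecessor and the support of its successor.\<close>

type_synonym decorated = "segment \<times> edge \<times> edge"

definition decorated_segments :: "(int \<Rightarrow> segment) set \<Rightarrow> decorated set" where
  "decorated_segments \<C> =
     {(C i, support (C (i - 1)), support (C (i + 1))) | C i. C \<in> \<C>}"

fun translate :: "point \<Rightarrow> decorated \<Rightarrow> decorated" where
  "translate v ((p, q), e, f) = ((v + p, v + q), (+) v ` e, (+) v ` f)"

fun vertices :: "decorated \<Rightarrow> point set" where
  "vertices (s, e, f) = support s \<union> e \<union> f"

definition real_point :: "point \<Rightarrow> real \<times> real" where
  "real_point p = (real_of_int (fst p), real_of_int (snd p))"

text \<open>Disks are convex, so a disk contains a set of edges iff it contains their endpoints.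
  The metric on \<open>real \<times> real\<close> is the Euclidean one.\<close>

definition local_isomorphism_property :: "(int \<Rightarrow> segment) set \<Rightarrow> bool" where
  "local_isomorphism_property \<C> \<longleftrightarrow>
     (\<forall>F. finite F \<and> F \<subseteq> decorated_segments \<C> \<longrightarrow>
       (\<exists>r>0. \<forall>z :: real \<times> real. \<exists>v.
          translate v ` F \<subseteq> decorated_segments \<C> \<and>
          (\<forall>d \<in> translate v ` F. real_point ` vertices d \<subseteq> cball z r)))"

end

theory Submission
  imports Defs
begin

text \<open>Identify the plane with the Gaussian integers, so that \<open>Lam n\<close> is the ideal generated by
  \<open>(1 + i) ^ n\<close>. Keeping only the vertices of a folding path whose index lies in \<open>E_n\<close> gives
  a folding path with the same turns, scaled by a generator of \<open>Lam n\<close>; hence an index lies in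
  \<open>E_n\<close> iff its vertex lies in the corresponding coset of \<open>Lam n\<close>.

  If all curves agree on type, on the cosets \<open>E_n\<close> and on the subwords of their sequences, then the
  orientation of the edges and the turn at every vertex outside \<open>E_n\<close> are invariant under
  translation by \<open>Lam (n + 1)\<close>. A finite pattern therefore recurs along a lattice; a vertex lying in
  all \<open>E_n\<close>, which is unique, is replaced by one of large finite level with the same turn.

  Conversely, every folding path covers all edges of arbitrarily large disks: coverage of a large
  region passes from the derived path to the path itself, and a case check starts the induction.
  Given two curves \<open>C\<close> and \<open>D\<close>, the local isomorphism property moves long pieces of both by one
  vector into a disk covered by \<open>D\<close>, so \<open>C\<close> and \<open>D\<close> have the same invariants.\<close>

subsection \<open>Complete folding sequences\<close>

text \<open>The sets \<open>E_seq n\<close> are reached through derivation: the entries off one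
  parity class alternate in sign, and the remaining ones form a complete folding sequence again, so
  statements about level \<open>n\<close> are inductions that peel off one level. Being of level
  exactly \<open>n\<close> is visible in a bounded window, which is why long common pieces transfer
  the invariants. The invariants leave open the turn at a vertex lying in every \<open>E_n\<close>;
  turns of finite level are forced by the type, the cosets and one sign per level. A pattern
  containing that vertex cannot be moved by just any vector of a fine enough lattice. In the
  converse direction the translation vector is unknown. Moving a piece of \<open>D\<close> along
  with the piece of \<open>C\<close> eliminates it: \<open>v + E_n(C) = E_n(D) = v + E_n(D)\<close>.
  The growth of covered disks has a threshold: two inflation steps take radius \<open>r\<close> to
  \<open>2 * r - 1\<close>, so radius 1 is stationary, and the finite case check is what leads from
  radius 1 to radius 2.\<close>

fun interleave :: "int \<Rightarrow> int list \<Rightarrow> int list" where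
  "interleave s [] = [s]"
| "interleave s (x # xs) = s # x # interleave (- s) xs"

lemma length_interleave: "length (interleave s xs) = 2 * length xs + 1"
  by (induction xs arbitrary: s) auto

lemma interleave_append:
  "interleave s (xs @ c # ys) = interleave s xs @ c # interleave ((- 1) ^ (length xs + 1) * s) ys"
  by (induction xs arbitrary: s) auto

lemma interleave_nth_even: "k \<le> length xs \<Longrightarrow> interleave s xs ! (2 * k) = (- 1) ^ k * s"
proof (induction xs arbitrary: s k)
  case (Cons x xs)
  then show ?case by (cases k) auto
qed auto

lemma interleave_nth_odd: "k < length xs \<Longrightarrow> interleave s xs ! (2 * k + 1) = xs ! k"
proof (induction xs arbitrary: s k)
  case (Cons x xs)
  then show ?case by (cases k) auto
qed auto

lemma bar_interleave: "bar (interleave s xs) = interleave ((- 1) ^ (length xs + 1) * s) (bar xs)"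
proof (induction xs arbitrary: s)
  case Nil
  then show ?case by (simp add: bar_def)
next
  case (Cons x xs)
  have "bar (interleave s (x # xs)) = bar (interleave (- s) xs) @ [- x, - s]"
    by (simp add: bar_def)
  also have "\<dots> = interleave ((- 1) ^ (length xs) * s) (bar xs) @ [- x, - s]"
    using Cons by simp
  also have "\<dots> = interleave ((- 1) ^ (length xs) * s) (bar xs @ (- x) # [])"
    unfolding interleave_append by (simp add: bar_def)
  finally show ?case by (simp add: bar_def)
qed

lemma folding_length: "folding n S \<Longrightarrow> length S = 2 ^ n - 1"
proof (induction rule: folding.induct)
  case (folding_pos n S)
  have "(1::nat) \<le> 2 ^ n" by simp
  with folding_pos show ?case by (simp add: bar_def del: one_le_power)
next
  case (folding_neg n S)
  have "(1::nat) \<le> 2 ^ n" by simp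
  with folding_neg show ?case by (simp add: bar_def del: one_le_power)
qed simp

lemma folding_values: "folding n S \<Longrightarrow> set S \<subseteq> {1, - 1}"
  by (induction rule: folding.induct) (auto simp: bar_def)

lemma folding_step: "folding n S \<Longrightarrow> c \<in> {1, - 1} \<Longrightarrow> folding (Suc n) (bar S @ c # S)"
  using folding_pos folding_neg by force

text \<open>The recursion of \<open>folding\<close> puts a new crease in the middle; this is the
  other description, in which the last fold inserts alternating creases between all old ones.
  \<open>bar\<close> respects that shape, so the two halves around \<open>c\<close> fit
  together.\<close>

lemma folding_interleave:
  "folding (Suc n) S \<Longrightarrow> \<exists>s T. folding n T \<and> S = interleave s T"
proof (induction n arbitrary: S)
  case 0
  then have "S = interleave 1 [] \<or> S = interleave (- 1) []"
    by (auto elim!: folding.cases simp: bar_def)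
  then show ?case using folding_0 by blast
next
  case (Suc n)
  from Suc.prems have "\<exists>U c. folding (Suc n) U \<and> c \<in> {1, - 1} \<and> S = bar U @ c # U"
    by (cases rule: folding.cases) auto
  then obtain U c where U: "folding (Suc n) U" "c \<in> {1, - 1}" "S = bar U @ c # U" by blast
  from Suc.IH[OF U(1)] obtain s T where T: "folding n T" "U = interleave s T" by blast
  show ?case
  proof (cases n)
    case 0
    with T have "T = []" using folding_length by fastforce
    then have "S = interleave (- s) [c]" using U T by (simp add: bar_def)
    moreover have "folding (Suc 0) [c]" using folding_step[OF folding_0 U(2)] by (simp add: bar_def)
    ultimately show ?thesis using 0 by blast
  next
    case (Suc k)
    \<comment> \<open>The length \<open>2 ^ n - 1\<close> is odd except for \<open>n = 0\<close>.
      Oddness makes the starting sign survive both \<open>bar\<close> and the passage across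
      \<open>c\<close>; in the other case it flips.\<close>
    have "odd (length T)" using folding_length[OF T(1)] Suc by simp
    then have "S = interleave s (bar T @ c # T)"
      unfolding interleave_append using U T by (simp add: bar_interleave) (simp add: bar_def)
    then show ?thesis using folding_step[OF T(1) U(2)] by blast
  qed
qed

lemma complete_folding_seq_iff:
  "complete_folding_seq a \<longleftrightarrow>
     (\<forall>M. \<exists>n S t. folding n S \<and>
        (\<forall>x. \<bar>x\<bar> \<le> M \<longrightarrow> 0 \<le> x + t \<and> x + t < int (length S) \<and> a x = S ! nat (x + t)))"
proof
  assume a: "complete_folding_seq a"
  show "\<forall>M. \<exists>n S t. folding n S \<and>
        (\<forall>x. \<bar>x\<bar> \<le> M \<longrightarrow> 0 \<le> x + t \<and> x + t < int (length S) \<and> a x = S ! nat (x + t))"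
  proof
    fix M :: int
    define m where "m = nat (2 * M + 1)"
    define w where "w = map (\<lambda>j. a (- M - 1 + int j)) [1..<Suc m]"
    have "w \<in> subwords a" unfolding w_def subwords_def by blast
    then obtain n S where S: "folding n S" "sublist w S"
      using a unfolding complete_folding_seq_def by blast
    then obtain ps ss where eq: "S = ps @ w @ ss" by (auto simp: sublist_def)
    have "0 \<le> x + (M + length ps) \<and> x + (M + length ps) < int (length S) \<and> a x = S ! nat (x + (M + length ps))"
      if "\<bar>x\<bar> \<le> M" for x
    proof -
      have *: "nat (x + (M + length ps)) = length ps + nat (x + M)" using that by auto
      have l: "nat (x + M) < length w" using that by (auto simp: w_def m_def)
      have "S ! nat (x + (M + length ps)) = w ! nat (x + M)"
        unfolding * eq using l by (simp add: nth_append)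
      also have "\<dots> = a x" using l that by (simp add: w_def abs_le_iff del: upt_Suc)
      finally show ?thesis using l that eq by auto
    qed
    then show "\<exists>n S t. folding n S \<and>
        (\<forall>x. \<bar>x\<bar> \<le> M \<longrightarrow> 0 \<le> x + t \<and> x + t < int (length S) \<and> a x = S ! nat (x + t))"
      using S(1) by blast
  qed
next
  assume a: "\<forall>M. \<exists>n S t. folding n S \<and>
        (\<forall>x. \<bar>x\<bar> \<le> M \<longrightarrow> 0 \<le> x + t \<and> x + t < int (length S) \<and> a x = S ! nat (x + t))"
  show "complete_folding_seq a"
    unfolding complete_folding_seq_def
  proof
    fix w assume "w \<in> subwords a"
    then obtain h m where w: "w = map (\<lambda>j. a (h + int j)) [1..<Suc m]"
      unfolding subwords_def by blast
    from a obtain n S t where S: "folding n S"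
      "\<And>x. \<bar>x\<bar> \<le> \<bar>h\<bar> + int m + 1 \<Longrightarrow> 0 \<le> x + t \<and> x + t < int (length S) \<and> a x = S ! nat (x + t)"
      by blast
    show "\<exists>n S. folding n S \<and> sublist w S"
    proof (cases "m = 0")
      case True
      then show ?thesis using S(1) by (auto simp: w)
    next
      case False
      have A: "0 \<le> h + 1 + t" using S(2)[of "h + 1"] False by auto
      have B: "h + int m + t < length S" using S(2)[of "h + int m"] by auto
      define p where "p = nat (h + 1 + t)"
      have "w = take m (drop p S)"
      proof (rule nth_equalityI)
        show "length w = length (take m (drop p S))"
          using A B by (simp add: w p_def)
        fix i assume "i < length w"
        then have i: "i < m" by (simp add: w del: upt_Suc)
        then have "w ! i = a (h + int (Suc i))" by (simp add: w del: upt_Suc)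
        also have "\<dots> = S ! nat (h + int (Suc i) + t)" using S(2)[of "h + int (Suc i)"] i by auto
        also have "nat (h + int (Suc i) + t) = p + i" using A by (auto simp: p_def)
        finally show "w ! i = take m (drop p S) ! i" using i A B by (simp add: p_def)
      qed
      then have "sublist w S" by (metis sublist_drop sublist_take sublist_order.order_trans)
      then show ?thesis using S(1) by blast
    qed
  qed
qed

lemma complete_folding_values: "complete_folding_seq a \<Longrightarrow> a x = 1 \<or> a x = - 1"
proof -
  assume "complete_folding_seq a"
  then obtain n S t where S: "folding n S"
    "\<And>y. \<bar>y\<bar> \<le> \<bar>x\<bar> \<Longrightarrow> 0 \<le> y + t \<and> y + t < int (length S) \<and> a y = S ! nat (y + t)"
    unfolding complete_folding_seq_iff by blast
  then have "a x \<in> set S" using S(2)[of x] by (simp add: nat_less_iff)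
  then show ?thesis using folding_values[OF S(1)] by auto
qed

section \<open>Derived sequences and levels of indices\<close>

definition derived_from :: "int \<Rightarrow> (int \<Rightarrow> int) \<Rightarrow> bool" where
  "derived_from e a \<longleftrightarrow> (\<forall>x. odd (x - e) \<longrightarrow> a (x + 2) = - a x) \<and>
     complete_folding_seq (\<lambda>x. a (e + 2 * x))"

text \<open>Each window, placed inside a finite folding sequence, shows some valid parity
  \<open>e\<close>, possibly a different one for different windows. Validity passes to smaller
  windows, so one of the two parities is valid for all of them.\<close>

lemma complete_folding_derived:
  assumes "complete_folding_seq a"
  obtains e where "derived_from e a"
proof -
  define good where "good M e \<longleftrightarrow>
     (\<forall>x. \<bar>x\<bar> \<le> M \<longrightarrow> \<bar>x + 2\<bar> \<le> M \<longrightarrow> odd (x - e) \<longrightarrow> a (x + 2) = - a x) \<and>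
     (\<exists>n S t. folding n S \<and> (\<forall>x. \<bar>e + 2 * x\<bar> \<le> M \<longrightarrow>
        0 \<le> x + t \<and> x + t < int (length S) \<and> a (e + 2 * x) = S ! nat (x + t)))" for M e :: int
  have mono: "good M e" if "good M' e" "M \<le> M'" for M M' e
    using that unfolding good_def by (meson order_trans)
  have ex: "good M 0 \<or> good M 1" for M
  proof -
    \<comment> \<open>\<open>max M 0\<close> keeps index 0 in the window, so \<open>S\<close> is
      nonempty and therefore an interleaving.\<close>
    obtain n S t where S: "folding n S"
      "\<And>x. \<bar>x\<bar> \<le> max M 0 \<Longrightarrow> 0 \<le> x + t \<and> x + t < int (length S) \<and> a x = S ! nat (x + t)"
      using assms unfolding complete_folding_seq_iff by blast
    have "S \<noteq> []" using S(2)[of 0] by auto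
    then obtain k where k: "n = Suc k" using S(1) by (cases n) (auto elim: folding.cases)
    then obtain s T where T: "folding k T" "S = interleave s T" using folding_interleave S(1) by blast
    have even: "a x = (- 1) ^ nat ((x + t) div 2) * s" if "\<bar>x\<bar> \<le> M" and ev: "even (x + t)" for x
    proof -
      have x: "0 \<le> x + t" "x + t < int (length S)" "a x = S ! nat (x + t)" using S(2)[of x] that by auto
      obtain j where j: "x + t = 2 * j" using ev by (rule evenE)
      have jj: "nat (x + t) = 2 * nat j" "(x + t) div 2 = j" unfolding j by simp_all
      have "nat j \<le> length T" using x(2) unfolding j T(2) length_interleave by simp
      then show ?thesis unfolding x(3) jj T(2) by (rule interleave_nth_even)
    qed
    have odd: "0 \<le> (x + t) div 2 \<and> (x + t) div 2 < int (length T) \<and> a x = T ! nat ((x + t) div 2)"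
      if "\<bar>x\<bar> \<le> M" and od: "odd (x + t)" for x
    proof -
      have x: "0 \<le> x + t" "x + t < int (length S)" "a x = S ! nat (x + t)" using S(2)[of x] that by auto
      obtain j where j: "x + t = 2 * j + 1" using od by (rule oddE)
      have j0: "0 \<le> j" using x(1) unfolding j by simp
      then have jj: "nat (x + t) = 2 * nat j + 1" "(x + t) div 2 = j" unfolding j by simp_all
      have l: "nat j < length T" using x(2) j0 unfolding j T(2) length_interleave by simp
      then have "a x = T ! nat j" unfolding x(3) jj T(2) by (rule interleave_nth_odd)
      with l j0 show ?thesis unfolding jj by simp
    qed
    \<comment> \<open>The odd places of \<open>interleave s T\<close> carry \<open>T\<close>, so
      \<open>e\<close> is the parity with \<open>e + t\<close> odd.\<close>
    define e :: int where "e = (if even t then 1 else 0)"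
    have et: "odd (e + t)" by (simp add: e_def)
    have "a (x + 2) = - a x" if "\<bar>x\<bar> \<le> M" "\<bar>x + 2\<bar> \<le> M" "odd (x - e)" for x
    proof -
      have p: "even (x + t)" using that et by auto
      have x: "0 \<le> x + t" using S(2)[of x] that by auto
      have n: "nat ((x + 2 + t) div 2) = Suc (nat ((x + t) div 2))" using x by simp
      have "even (x + 2 + t)" using p by simp
      from even[OF that(2) this] even[OF that(1) p] show ?thesis unfolding n by simp
    qed
    moreover have "0 \<le> x + (e + t) div 2 \<and> x + (e + t) div 2 < int (length T) \<and>
        a (e + 2 * x) = T ! nat (x + (e + t) div 2)" if "\<bar>e + 2 * x\<bar> \<le> M" for x
    proof -
      have "(e + 2 * x + t) div 2 = x + (e + t) div 2" by auto
      then show ?thesis using odd[of "e + 2 * x"] that et by auto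
    qed
    ultimately have "good M e" unfolding good_def using T(1) by blast
    then show ?thesis by (auto simp: e_def split: if_splits)
  qed
  have "\<exists>e. \<forall>M. good M e"
  proof (rule ccontr)
    assume "\<not> ?thesis"
    then obtain M0 M1 where "\<not> good M0 0" "\<not> good M1 1" by blast
    then have "\<not> good (max M0 M1) 0" "\<not> good (max M0 M1) 1" using mono by (meson max.cobounded1 max.cobounded2)+
    then show False using ex by blast
  qed
  then obtain e where e: "\<And>M. good M e" by blast
  have "a (x + 2) = - a x" if "odd (x - e)" for x
    using e[of "\<bar>x\<bar> + 2"] that unfolding good_def by auto
  moreover have "complete_folding_seq (\<lambda>x. a (e + 2 * x))"
    unfolding complete_folding_seq_iff
  proof
    fix M
    have "\<exists>n S t. folding n S \<and> (\<forall>x. \<bar>e + 2 * x\<bar> \<le> \<bar>e\<bar> + 2 * \<bar>M\<bar> \<longrightarrow>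
        0 \<le> x + t \<and> x + t < int (length S) \<and> a (e + 2 * x) = S ! nat (x + t))"
      using e unfolding good_def by blast
    then show "\<exists>n S t. folding n S \<and> (\<forall>x. \<bar>x\<bar> \<le> M \<longrightarrow>
        0 \<le> x + t \<and> x + t < int (length S) \<and> a (e + 2 * x) = S ! nat (x + t))"
      by (smt (verit))
  qed
  ultimately show ?thesis using that unfolding derived_from_def by blast
qed


lemma even_diffE:
  fixes x e :: int
  assumes "even (x - e)"
  obtains y where "x = e + 2 * y"
proof -
  obtain k where "x - e = 2 * k" using assms by (rule evenE)
  then have "x = e + 2 * k" by simp
  then show ?thesis by (rule that)
qed

lemma derived_from_alternating:
  assumes "derived_from e a" "odd (x - e)"
  shows "a (x + 2 * k) = (if even k then a x else - a x)"
proof (induction k rule: int_induct[where k = 0])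
  case (step1 i)
  have "odd (x + 2 * i - e)" using assms(2) by simp
  then have "a (x + 2 * i + 2) = - a (x + 2 * i)"
    using assms(1) unfolding derived_from_def by blast
  then show ?case using step1 by (simp add: algebra_simps)
next
  case (step2 i)
  have "odd (x + 2 * (i - 1) - e)" using assms(2) by simp
  then have "a (x + 2 * (i - 1) + 2) = - a (x + 2 * (i - 1))"
    using assms(1) unfolding derived_from_def by blast
  then show ?case using step2 by (simp add: algebra_simps split: if_splits)
qed simp

lemma complete_folding_sign_change:
  assumes "complete_folding_seq a"
  shows "a (x + 2) = - a x \<or> a (x + 3) = - a (x + 1)"
proof -
  obtain e where e: "derived_from e a" using complete_folding_derived[OF assms] .
  show ?thesis
  proof (cases "odd (x - e)")
    case True
    then show ?thesis using e by (simp add: derived_from_def)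
  next
    case False
    then have "odd (x + 1 - e)" by simp
    then have "a (x + 1 + 2) = - a (x + 1)" using e unfolding derived_from_def by blast
    then show ?thesis by (simp add: add.commute)
  qed
qed

lemma complete_folding_nonzero: "complete_folding_seq a \<Longrightarrow> a x \<noteq> - a x"
  using complete_folding_values[of a x] by auto

text \<open>With the other parity the derived sequence would alternate at every place, against
  \<open>complete_folding_sign_change\<close>. In particular the parity of \<open>e\<close> is
  forced.\<close>

lemma alternates_at_0_iff:
  assumes "complete_folding_seq a" "derived_from e a"
  shows "alternates_at 0 a x \<longleftrightarrow> odd (x - e)"
proof
  assume "odd (x - e)"
  then show "alternates_at 0 a x"
    using derived_from_alternating[OF assms(2)] by (simp add: alternates_at_def mult.commute)
next
  assume A: "alternates_at 0 a x"
  show "odd (x - e)"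
  proof
    assume "even (x - e)"
    then obtain y where y: "x = e + 2 * y" by (rule even_diffE)
    define a' where "a' z = a (e + 2 * z)" for z
    have c: "complete_folding_seq a'" using assms(2) unfolding derived_from_def a'_def by blast
    have "a' (y + k) = (if even k then a' y else - a' y)" for k
      using A unfolding alternates_at_def a'_def y by (simp add: algebra_simps)
    from this[of 1] this[of 2] this[of 3] complete_folding_sign_change[OF c, of y]
    show False using complete_folding_nonzero[OF c, of y] by auto
  qed
qed

text \<open>Off the class of \<open>e\<close> the values have period 4, which divides
  \<open>2 ^ (n + 2)\<close>, so they cannot alternate with that step. On the class, halving the
  index turns the step into that of level \<open>n\<close>.\<close>

lemma alternates_at_Suc_iff:
  assumes "complete_folding_seq a" "derived_from e a"
  shows "alternates_at (Suc n) a x \<longleftrightarrow>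
    even (x - e) \<and> alternates_at n (\<lambda>y. a (e + 2 * y)) ((x - e) div 2)"
proof (cases "even (x - e)")
  case True
  then obtain y where y: "x = e + 2 * y" by (rule even_diffE)
  show ?thesis unfolding alternates_at_def y by (simp add: algebra_simps)
next
  case False
  have "a (x + 2 * 2 ^ Suc n) = a x"
    unfolding derived_from_alternating[OF assms(2) False] by simp
  then have "\<not> alternates_at (Suc n) a x"
    unfolding alternates_at_def using complete_folding_nonzero[OF assms(1), of x]
    by (intro notI) (drule spec[of _ 1], simp)
  then show ?thesis using False by blast
qed

lemma alternates_at_ex: "complete_folding_seq a \<Longrightarrow> \<exists>h. alternates_at n a h"
proof (induction n arbitrary: a)
  case 0
  obtain e where e: "derived_from e a" using complete_folding_derived[OF 0] .
  have "alternates_at 0 a (e + 1)" using alternates_at_0_iff[OF 0 e] by simp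
  then show ?case by blast
next
  case (Suc n)
  obtain e where e: "derived_from e a" using complete_folding_derived[OF Suc.prems] .
  obtain h where h: "alternates_at n (\<lambda>y. a (e + 2 * y)) h"
    using Suc.IH e unfolding derived_from_def by blast
  have "alternates_at (Suc n) a (e + 2 * h)" using alternates_at_Suc_iff[OF Suc.prems e] h by simp
  then show ?case by blast
qed

lemma half_dvd_diff:
  fixes x y e :: int
  assumes "even (x - e)" "even (y - e)"
  shows "m dvd (x - e) div 2 - (y - e) div 2 \<longleftrightarrow> 2 * m dvd x - y"
proof -
  obtain u where u: "x = e + 2 * u" using assms(1) by (rule even_diffE)
  obtain v where v: "y = e + 2 * v" using assms(2) by (rule even_diffE)
  have "m dvd (x - e) div 2 - (y - e) div 2 \<longleftrightarrow> 2 * m dvd 2 * (u - v)"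
    unfolding dvd_mult_cancel_left using u v by simp
  also have "2 * (u - v) = x - y" using u v by simp
  finally show ?thesis .
qed

text \<open>This makes the choice operator in \<open>E_seq\<close> harmless. The admissible indices
  are those of level exactly \<open>n\<close>: one half of \<open>E_seq n\<close>, the other half
  being \<open>E_seq (Suc n)\<close>.\<close>

lemma alternates_at_iff:
  "complete_folding_seq a \<Longrightarrow> alternates_at n a h \<Longrightarrow> alternates_at n a x \<longleftrightarrow> 2 ^ Suc n dvd x - h"
proof (induction n arbitrary: a x h)
  case 0
  obtain e where e: "derived_from e a" using complete_folding_derived[OF 0(1)] .
  show ?case using alternates_at_0_iff[OF 0(1) e] 0(2) by auto
next
  case (Suc n)
  obtain e where e: "derived_from e a" using complete_folding_derived[OF Suc.prems(1)] .
  note iff = alternates_at_Suc_iff[OF Suc.prems(1) e]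
  have h: "even (h - e)" "alternates_at n (\<lambda>y. a (e + 2 * y)) ((h - e) div 2)" using iff Suc.prems(2) by auto
  have c: "complete_folding_seq (\<lambda>y. a (e + 2 * y))" using e unfolding derived_from_def by blast
  show ?case
  proof (cases "even (x - e)")
    case True
    have "alternates_at (Suc n) a x \<longleftrightarrow> 2 ^ Suc n dvd (x - e) div 2 - (h - e) div 2"
      using iff True Suc.IH[OF c h(2)] by blast
    then show ?thesis using half_dvd_diff[OF True h(1), of "2 ^ Suc n"] by simp
  next
    case False
    then have "odd (x - h)" using h(1) by auto
    then have "\<not> 2 ^ Suc (Suc n) dvd x - h" by (meson dvd_power dvd_trans zero_less_Suc)
    then show ?thesis using iff False by blast
  qed
qed

lemma E_seq_eq:
  assumes "complete_folding_seq a" "alternates_at n a h"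
  shows "E_seq n a = {x. 2 ^ n dvd x - h}"
proof -
  define g where "g = (SOME h. alternates_at n a h)"
  have "alternates_at n a g" unfolding g_def using assms(2) by (rule someI)
  then have "2 ^ Suc n dvd g - h" using alternates_at_iff[OF assms] by blast
  then have gh: "2 ^ n dvd g - h" by (metis dvd_mult_right power_Suc)
  have "E_seq n a = {g + k * 2 ^ n | k. True}" unfolding E_seq_def g_def Let_def ..
  also have "\<dots> = {x. 2 ^ n dvd x - g}"
  proof -
    have "\<exists>k. x = g + k * 2 ^ n" if "2 ^ n dvd x - g" for x
      using that by (intro exI[of _ "(x - g) div 2 ^ n"]) simp
    then show ?thesis by auto
  qed
  also have "\<dots> = {x. 2 ^ n dvd x - h}"
  proof (intro Collect_cong)
    fix x
    have "x - h = (x - g) + (g - h)" by simp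
    then show "2 ^ n dvd x - g \<longleftrightarrow> 2 ^ n dvd x - h" using dvd_add_left_iff[OF gh] by metis
  qed
  finally show ?thesis .
qed

lemma E_seq_nonempty: "complete_folding_seq a \<Longrightarrow> \<exists>x. x \<in> E_seq n a"
proof -
  assume a: "complete_folding_seq a"
  obtain h where "alternates_at n a h" using alternates_at_ex[OF a] by blast
  then have "h \<in> E_seq n a" using E_seq_eq[OF a] by simp
  then show ?thesis ..
qed

lemma E_seq_iff:
  assumes "complete_folding_seq a" "x \<in> E_seq n a"
  shows "y \<in> E_seq n a \<longleftrightarrow> 2 ^ n dvd y - x"
proof -
  obtain h where "alternates_at n a h" using alternates_at_ex[OF assms(1)] by blast
  from E_seq_eq[OF assms(1) this] have E: "E_seq n a = {x. 2 ^ n dvd x - h}" .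
  then have "2 ^ n dvd x - h" using assms(2) by blast
  then have "2 ^ n dvd y - x \<longleftrightarrow> 2 ^ n dvd y - h" using dvd_add_left_iff[of "2 ^ n" "x - h" "y - x"] by simp
  then show ?thesis using E by blast
qed

lemma E_seq_0: "complete_folding_seq a \<Longrightarrow> E_seq 0 a = UNIV"
proof -
  assume a: "complete_folding_seq a"
  obtain x where "x \<in> E_seq 0 a" using E_seq_nonempty[OF a] by blast
  from E_seq_iff[OF a this] show ?thesis by (simp add: set_eq_iff)
qed

lemma E_seq_Suc:
  assumes "complete_folding_seq a" "derived_from e a"
  shows "x \<in> E_seq (Suc n) a \<longleftrightarrow> even (x - e) \<and> (x - e) div 2 \<in> E_seq n (\<lambda>y. a (e + 2 * y))"
proof -
  have c: "complete_folding_seq (\<lambda>y. a (e + 2 * y))" using assms(2) unfolding derived_from_def by blast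
  obtain h where h: "alternates_at (Suc n) a h" using alternates_at_ex[OF assms(1)] by blast
  have h': "even (h - e)" "alternates_at n (\<lambda>y. a (e + 2 * y)) ((h - e) div 2)"
    using alternates_at_Suc_iff[OF assms] h by auto
  show ?thesis
  proof (cases "even (x - e)")
    case True
    show ?thesis using half_dvd_diff[OF True h'(1), of "2 ^ n"] True
      unfolding E_seq_eq[OF assms(1) h] E_seq_eq[OF c h'(2)] by simp
  next
    case False
    then have "odd (x - h)" using h'(1) by auto
    then have "\<not> 2 ^ Suc n dvd x - h" by (meson dvd_power dvd_trans zero_less_Suc)
    then show ?thesis using False unfolding E_seq_eq[OF assms(1) h] by simp
  qed
qed

lemma E_seq_alternates:
  "complete_folding_seq a \<Longrightarrow> x \<in> E_seq n a \<Longrightarrow> x \<notin> E_seq (Suc n) a \<Longrightarrow> alternates_at n a x"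
proof (induction n arbitrary: a x)
  case 0
  obtain e where e: "derived_from e a" using complete_folding_derived[OF 0(1)] .
  have c: "complete_folding_seq (\<lambda>y. a (e + 2 * y))" using e unfolding derived_from_def by blast
  show ?case using 0 alternates_at_0_iff[OF 0(1) e] E_seq_Suc[OF 0(1) e] E_seq_0[OF c] by auto
next
  case (Suc n)
  obtain e where e: "derived_from e a" using complete_folding_derived[OF Suc.prems(1)] .
  have c: "complete_folding_seq (\<lambda>y. a (e + 2 * y))" using e unfolding derived_from_def by blast
  show ?case using Suc.IH[OF c] Suc.prems
    unfolding E_seq_Suc[OF Suc.prems(1) e] alternates_at_Suc_iff[OF Suc.prems(1) e] by blast
qed

lemma E_seq_Suc_subset: "complete_folding_seq a \<Longrightarrow> E_seq (Suc n) a \<subseteq> E_seq n a"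
proof (induction n arbitrary: a)
  case 0
  then show ?case using E_seq_0 by blast
next
  case (Suc n)
  obtain e where e: "derived_from e a" using complete_folding_derived[OF Suc.prems(1)] .
  have c: "complete_folding_seq (\<lambda>y. a (e + 2 * y))" using e unfolding derived_from_def by blast
  show ?case using Suc.IH[OF c] E_seq_Suc[OF Suc.prems(1) e] by blast
qed

lemma E_seq_antimono: "complete_folding_seq a \<Longrightarrow> m \<le> n \<Longrightarrow> E_seq n a \<subseteq> E_seq m a"
  using E_seq_Suc_subset by (rule lift_Suc_antimono_le) auto

lemma E_seq_add: "complete_folding_seq a \<Longrightarrow> x \<in> E_seq n a \<Longrightarrow> x + k * 2 ^ n \<in> E_seq n a"
  using E_seq_iff[of a x n "x + k * 2 ^ n"] by simp

lemma E_seq_half: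
  assumes "complete_folding_seq a" "x \<in> E_seq n a"
  shows "x + 2 ^ n \<in> E_seq (Suc n) a \<longleftrightarrow> x \<notin> E_seq (Suc n) a"
    and "x - 2 ^ n \<in> E_seq (Suc n) a \<longleftrightarrow> x \<notin> E_seq (Suc n) a"
proof -
  obtain y where y: "y \<in> E_seq (Suc n) a" using E_seq_nonempty[OF assms(1)] by blast
  then have "y \<in> E_seq n a" using E_seq_Suc_subset[OF assms(1)] by blast
  then have "2 ^ n dvd x - y" using E_seq_iff assms by blast
  then obtain k where k: "x - y = 2 ^ n * k" by blast
  have *: "y + 2 ^ n * j \<in> E_seq (Suc n) a \<longleftrightarrow> even j" for j
    using E_seq_iff[OF assms(1) y, of "y + 2 ^ n * j"] by (simp add: mult.commute)
  have x: "x = y + 2 ^ n * k" "x + 2 ^ n = y + 2 ^ n * (k + 1)" "x - 2 ^ n = y + 2 ^ n * (k - 1)"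
    using k by (auto simp: algebra_simps)
  have "x \<in> E_seq (Suc n) a \<longleftrightarrow> even k" unfolding x(1) by (rule *)
  moreover have "x + 2 ^ n \<in> E_seq (Suc n) a \<longleftrightarrow> even (k + 1)" unfolding x(2) by (rule *)
  moreover have "x - 2 ^ n \<in> E_seq (Suc n) a \<longleftrightarrow> even (k - 1)" unfolding x(3) by (rule *)
  ultimately show "x + 2 ^ n \<in> E_seq (Suc n) a \<longleftrightarrow> x \<notin> E_seq (Suc n) a"
     "x - 2 ^ n \<in> E_seq (Suc n) a \<longleftrightarrow> x \<notin> E_seq (Suc n) a"
    by simp_all
qed

text \<open>The three alternatives correspond to \<open>x\<close> having level exactly \<open>n\<close>, lower than \<open>n\<close>
  and higher than \<open>n\<close>; the last two are incompatible with four consecutive sign changes.\<close>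

lemma level_trichotomy:
  "complete_folding_seq a \<Longrightarrow> alternates_at n a x \<or> a (x + 2 ^ Suc n) = a x \<or>
     a (x + 2 * 2 ^ Suc n) = - a x \<or> a (x + 3 * 2 ^ Suc n) = - a (x + 2 ^ Suc n)"
proof (induction n arbitrary: a x)
  case 0
  obtain e where e: "derived_from e a" using complete_folding_derived[OF 0(1)] .
  have c: "complete_folding_seq (\<lambda>y. a (e + 2 * y))" using e unfolding derived_from_def by blast
  show ?case
  proof (cases "odd (x - e)")
    case True
    then show ?thesis using alternates_at_0_iff[OF 0 e] by blast
  next
    case False
    then have "even (x - e)" by simp
    then obtain y where y: "x = e + 2 * y" by (rule even_diffE)
    show ?thesis using complete_folding_sign_change[OF c, of y] unfolding y by (simp add: algebra_simps)
  qed
next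
  case (Suc n)
  obtain e where e: "derived_from e a" using complete_folding_derived[OF Suc.prems] .
  have c: "complete_folding_seq (\<lambda>y. a (e + 2 * y))" using e unfolding derived_from_def by blast
  show ?case
  proof (cases "odd (x - e)")
    case True
    have "a (x + 2 * 2 ^ Suc n) = a x"
      unfolding derived_from_alternating[OF e True] by simp
    then show ?thesis by simp
  next
    case False
    then have "even (x - e)" by simp
    then obtain y where y: "x = e + 2 * y" by (rule even_diffE)
    have "(x - e) div 2 = y" "even (x - e)" using y by auto
    then show ?thesis using Suc.IH[OF c, of y] alternates_at_Suc_iff[OF Suc.prems e, of n x]
      unfolding y by (simp add: algebra_simps)
  qed
qed

text \<open>Four values spaced by \<open>2 ^ (n + 1)\<close> with alternating signs certify level
  exactly \<open>n\<close>, by \<open>level_trichotomy\<close>, and a window of this size contains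
  such a quadruple.\<close>

lemma E_seq_window:
  assumes a: "complete_folding_seq a" and b: "complete_folding_seq b"
    and eq: "\<And>x. \<bar>x\<bar> \<le> 2 ^ (n + 4) \<Longrightarrow> b (t + x) = a x"
  shows "t + x \<in> E_seq n b \<longleftrightarrow> x \<in> E_seq n a"
proof -
  obtain h where h: "alternates_at n a h" using alternates_at_ex[OF a] by blast
  \<comment> \<open>The reduction puts the points \<open>g + k * 2 ^ (n + 1)\<close> with
    \<open>k \<le> 3\<close> below \<open>4 * 2 ^ (n + 1)\<close>, which is half the radius of the
    window.\<close>
  define g where "g = h mod 2 ^ Suc n"
  have g: "alternates_at n a g"
    using alternates_at_iff[OF a h] unfolding g_def by (simp add: mod_eq_dvd_iff[symmetric] del: power_Suc)
  have g0: "0 \<le> g" "g < 2 ^ Suc n" unfolding g_def by (auto intro: pos_mod_bound simp del: power_Suc)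
  have "b (t + g + k * 2 ^ Suc n) = (if even k then a g else - a g)" if "0 \<le> k" "k \<le> 3" for k
  proof -
    have "k * 2 ^ Suc n \<le> 3 * 2 ^ Suc n" using that by (intro mult_right_mono) auto
    moreover have "0 \<le> k * 2 ^ Suc n" using that by auto
    moreover have "(2::int) ^ (n + 4) = 8 * 2 ^ Suc n" by (simp add: power_add)
    ultimately have "\<bar>g + k * 2 ^ Suc n\<bar> \<le> 2 ^ (n + 4)" using g0 by linarith
    then have "b (t + (g + k * 2 ^ Suc n)) = a (g + k * 2 ^ Suc n)" using eq by blast
    also have "\<dots> = (if even k then a g else - a g)" using g unfolding alternates_at_def by simp
    finally show ?thesis by (simp add: add.assoc)
  qed
  from this[of 0] this[of 1] this[of 2] this[of 3]
  have "alternates_at n b (t + g)"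
    using level_trichotomy[OF b, of n "t + g"] complete_folding_nonzero[OF a, of g] by auto
  then show ?thesis using E_seq_eq[OF b] E_seq_eq[OF a g] by simp
qed

subsection \<open>Folding paths and the lattices\<close>

definition rot :: "int \<Rightarrow> point \<Rightarrow> point" where
  "rot s p = (- s * snd p, s * fst p)"

text \<open>Multiplication by \<open>1 + i\<close> in the Gaussian integers, as \<open>rot 1\<close> is multiplication by \<open>i\<close>.\<close>

definition spread :: "point \<Rightarrow> point" where
  "spread p = (fst p - snd p, fst p + snd p)"

lemma spread_eq: "spread p = p + rot 1 p"
  by (simp add: spread_def rot_def prod_eq_iff)

lemma spread_add: "spread (p + q) = spread p + spread q"
  and spread_diff: "spread (p - q) = spread p - spread q"
  and spread_minus: "spread (- p) = - spread p"
  and spread_rot: "spread (rot s p) = rot s (spread p)"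
  and spread_0: "spread 0 = 0"
  by (simp_all add: spread_def rot_def prod_eq_iff algebra_simps)

lemma spread_inject: "spread p = spread q \<longleftrightarrow> p = q"
  by (auto simp: spread_def prod_eq_iff)

lemma Lam_0: "Lam 0 = UNIV"
  by (auto simp: Lam_def)

text \<open>As \<open>1 + i\<close> squared is \<open>2 * i\<close>, the two parity cases of the
  definition merge into one recursion, on which the later inductions rest.\<close>

lemma Lam_Suc: "Lam (Suc n) = spread ` Lam n"
proof (cases "even n")
  case True
  define c :: int where "c = 2 ^ (n div 2)"
  have A: "Lam n = {(c * x, c * y) | x y. True}"
    using True by (simp add: Lam_def c_def Let_def)
  have B: "Lam (Suc n) = {(x * c + y * c, x * c - y * c) | x y. True}"
    using True by (simp add: Lam_def c_def Let_def)
  show ?thesis unfolding A B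
  proof (intro set_eqI iffI)
    fix p assume "p \<in> {(x * c + y * c, x * c - y * c) | x y. True}"
    then obtain x y where "p = (x * c + y * c, x * c - y * c)" by blast
    then have "p = spread (c * x, c * (- y))" by (simp add: spread_def)
    then show "p \<in> spread ` {(c * x, c * y) | x y. True}" by blast
  next
    fix p assume "p \<in> spread ` {(c * x, c * y) | x y. True}"
    then obtain x y where "p = spread (c * x, c * y)" by blast
    then have "p = (x * c + (- y) * c, x * c - (- y) * c)" by (simp add: spread_def)
    then show "p \<in> {(x * c + y * c, x * c - y * c) | x y. True}" by blast
  qed
next
  case False
  define c :: int where "c = 2 ^ (n div 2)"
  have A: "Lam n = {(x * c + y * c, x * c - y * c) | x y. True}"
    using False by (simp add: Lam_def c_def Let_def)
  have B: "Lam (Suc n) = {(2 * c * x, 2 * c * y) | x y. True}"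
    using False by (simp add: Lam_def c_def Let_def)
  show ?thesis unfolding A B
  proof (intro set_eqI iffI)
    fix p assume "p \<in> {(2 * c * x, 2 * c * y) | x y. True}"
    then obtain x y where "p = (2 * c * x, 2 * c * y)" by blast
    then have "p = spread (y * c + x * c, y * c - x * c)" by (simp add: spread_def)
    then show "p \<in> spread ` {(x * c + y * c, x * c - y * c) | x y. True}" by blast
  next
    fix p assume "p \<in> spread ` {(x * c + y * c, x * c - y * c) | x y. True}"
    then obtain x y where "p = spread (x * c + y * c, x * c - y * c)" by blast
    then have "p = (2 * c * y, 2 * c * x)" by (simp add: spread_def)
    then show "p \<in> {(2 * c * x, 2 * c * y) | x y. True}" by blast
  qed
qed

lemma spread_in_Lam: "spread p \<in> Lam (Suc n) \<longleftrightarrow> p \<in> Lam n"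
  by (auto simp: Lam_Suc spread_inject)

lemma Lam_zero: "0 \<in> Lam n"
proof (induction n)
  case (Suc n)
  then show ?case using spread_in_Lam[of 0 n] by (simp add: spread_0)
qed (simp add: Lam_0)

lemma Lam_add: "p \<in> Lam n \<Longrightarrow> q \<in> Lam n \<Longrightarrow> p + q \<in> Lam n"
proof (induction n arbitrary: p q)
  case (Suc n)
  then obtain p' q' where "p = spread p'" "q = spread q'" "p' \<in> Lam n" "q' \<in> Lam n"
    by (auto simp: Lam_Suc)
  then show ?case using Suc.IH by (simp add: spread_in_Lam flip: spread_add)
qed (simp add: Lam_0)

lemma Lam_minus: "- p \<in> Lam n \<longleftrightarrow> p \<in> Lam n"
proof -
  have "- p \<in> Lam n" if "p \<in> Lam n" for p
    using that
  proof (induction n arbitrary: p)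
    case (Suc n)
    then obtain p' where "p = spread p'" "p' \<in> Lam n" by (auto simp: Lam_Suc)
    then show ?case using Suc.IH by (simp add: spread_in_Lam flip: spread_minus)
  qed (simp add: Lam_0)
  from this[of p] this[of "- p"] show ?thesis by auto
qed

lemma Lam_diff: "p \<in> Lam n \<Longrightarrow> q \<in> Lam n \<Longrightarrow> p - q \<in> Lam n"
  using Lam_add[of p n "- q"] by (simp add: Lam_minus)

lemma Lam_add_iff: "q \<in> Lam n \<Longrightarrow> p + q \<in> Lam n \<longleftrightarrow> p \<in> Lam n"
  using Lam_diff[of "p + q" n q] Lam_add[of p n q] by auto

lemma Lam_rot: "s = 1 \<or> s = - 1 \<Longrightarrow> rot s p \<in> Lam n \<longleftrightarrow> p \<in> Lam n"
proof -
  assume s: "s = 1 \<or> s = - 1"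
  have *: "rot s p \<in> Lam n" if "p \<in> Lam n" for s p
    using that
  proof (induction n arbitrary: p)
    case (Suc n)
    then obtain p' where "p = spread p'" "p' \<in> Lam n" by (auto simp: Lam_Suc)
    then show ?case using Suc.IH by (simp add: spread_in_Lam flip: spread_rot)
  qed (simp add: Lam_0)
  have "rot (- s) (rot s p) = p" using s by (auto simp: rot_def)
  then show ?thesis using *[of p s] *[of "rot s p" "- s"] by auto
qed

text \<open>\<open>p + rot s p\<close> is \<open>p\<close> times \<open>1 + s * i\<close>, and
  \<open>1 - i\<close> is \<open>1 + i\<close> times a unit.\<close>

lemma Lam_turn: "s = 1 \<or> s = - 1 \<Longrightarrow> p + rot s p \<in> Lam (Suc n) \<longleftrightarrow> p \<in> Lam n"
proof (elim disjE)
  assume "s = - 1"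
  moreover have "p + rot (- 1) p = rot (- 1) (spread p)" by (simp add: rot_def spread_def prod_eq_iff)
  ultimately show ?thesis by (simp add: Lam_rot spread_in_Lam)
qed (simp add: spread_eq[symmetric] spread_in_Lam)

lemma Lam_Suc_subset: "Lam (Suc n) \<subseteq> Lam n"
proof (induction n)
  case (Suc n)
  then show ?case unfolding Lam_Suc[of "Suc n"] Lam_Suc[of n] by (simp add: image_mono)
qed (simp add: Lam_0)

lemma Lam_antimono: "m \<le> n \<Longrightarrow> Lam n \<subseteq> Lam m"
  using Lam_Suc_subset by (rule lift_Suc_antimono_le)

lemma Lam_1_iff: "p \<in> Lam (Suc 0) \<longleftrightarrow> even (fst p + snd p)"
proof -
  obtain x y where p: "p = (x, y)" by fastforce
  have "p \<in> Lam (Suc 0) \<longleftrightarrow> (\<exists>u v. x = u + v \<and> y = u - v)" by (auto simp: Lam_def p)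
  also have "\<dots> \<longleftrightarrow> even (x + y)"
  proof
    assume "even (x + y)"
    then obtain u where "x + y = 2 * u" by (rule evenE)
    then have "x = u + (u - y) \<and> y = u - (u - y)" by auto
    then show "\<exists>u v. x = u + v \<and> y = u - v" by blast
  qed auto
  finally show ?thesis by (simp add: p)
qed

text \<open>Expresses that \<open>Lam (Suc n)\<close> has index two in \<open>Lam n\<close>; for
  \<open>n = 0\<close> this is the parity of the coordinate sum.\<close>

lemma Lam_index_two:
  "p \<in> Lam n \<Longrightarrow> p \<notin> Lam (Suc n) \<Longrightarrow> q \<in> Lam n \<Longrightarrow> q \<notin> Lam (Suc n) \<Longrightarrow> p + q \<in> Lam (Suc n)"
proof (induction n arbitrary: p q)
  case 0
  then show ?case by (auto simp: Lam_1_iff)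
next
  case (Suc n)
  then obtain p' q' where *: "p = spread p'" "q = spread q'" "p' \<in> Lam n" "q' \<in> Lam n"
    by (auto simp: Lam_Suc[of n])
  then have "p' \<notin> Lam (Suc n)" "q' \<notin> Lam (Suc n)" using Suc.prems spread_in_Lam by blast+
  then have "p' + q' \<in> Lam (Suc n)" using * Suc.IH by blast
  then show ?case using * by (simp add: spread_in_Lam flip: spread_add)
qed

lemma Lam_add_odd:
  assumes "p \<in> Lam n" "p \<notin> Lam (Suc n)" "q \<in> Lam n"
  shows "p + q \<in> Lam n" "p + q \<in> Lam (Suc n) \<longleftrightarrow> q \<notin> Lam (Suc n)"
  using Lam_add[OF assms(1,3)] Lam_index_two[OF assms] Lam_add_iff[of q "Suc n" p] assms(2) by blast+

lemma segment_notin_Lam: "is_segment s \<Longrightarrow> dir s \<notin> Lam (Suc 0)"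
  by (auto simp: Lam_1_iff is_segment_def)

lemma scaled_in_Lam: "(2 ^ n * x, 2 ^ n * y) \<in> Lam n"
proof -
  have "(2 ^ n * x, 2 ^ n * y) \<in> Lam (2 * n)" by (auto simp: Lam_def Let_def)
  then show ?thesis using Lam_antimono[of n "2 * n"] by auto
qed

text \<open>Only 0 is divisible by all powers of \<open>1 + i\<close>. Hence a vertex lying in all
  \<open>E_n\<close> is unique.\<close>

lemma Lam_Inter: "(\<And>n. p \<in> Lam n) \<Longrightarrow> p = 0"
proof -
  assume p: "\<And>n. p \<in> Lam n"
  have dvd: "2 ^ n dvd fst p \<and> 2 ^ n dvd snd p" for n :: nat
    using p[of "2 * n"] by (auto simp: Lam_def Let_def)
  have "z = 0" if "\<And>n::nat. 2 ^ n dvd z" for z :: int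
  proof (rule ccontr)
    assume "z \<noteq> 0"
    then have "\<bar>2 ^ nat \<bar>z\<bar>\<bar> \<le> \<bar>z\<bar>" using that[of "nat \<bar>z\<bar>"] by (rule dvd_imp_le_int)
    moreover have "nat \<bar>z\<bar> < 2 ^ nat \<bar>z\<bar>" by (rule less_exp)
    then have "int (nat \<bar>z\<bar>) < int (2 ^ nat \<bar>z\<bar>)" by (simp only: of_nat_less_iff)
    ultimately show False by simp
  qed
  from this[of "fst p"] this[of "snd p"] dvd show ?thesis by (auto simp: prod_eq_iff)
qed

text \<open>\<open>a i\<close> is the turn made at the vertex \<open>P i\<close>. Repeated edges are
  allowed, so that passing to the derived path is a matter of steps and turns only.\<close>

definition folding_path :: "(int \<Rightarrow> point) \<Rightarrow> (int \<Rightarrow> int) \<Rightarrow> bool" where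
  "folding_path P a \<longleftrightarrow> complete_folding_seq a \<and> (\<forall>i. is_segment (P i, P (i + 1))) \<and>
     (\<forall>i. P (i + 1) - P i = rot (a i) (P i - P (i - 1)))"

lemma curve_turn:
  assumes "complete_curve C"
  shows "dir (C (i + 1)) = rot (assoc_seq C i) (dir (C i))"
proof -
  have "is_segment (C i)" "is_segment (C (i + 1))" "perpendicular (C i) (C (i + 1))"
    using assms unfolding complete_curve_def by blast+
  then show ?thesis
    by (auto simp: is_segment_def perpendicular_def assoc_seq_def left_turn_def rot_def)
qed

lemma curve_step: "complete_curve C \<Longrightarrow> snd (C i) - snd (C (i - 1)) = dir (C i)"
  unfolding complete_curve_def dir_def by (metis diff_add_cancel)

lemma curve_fst: "complete_curve C \<Longrightarrow> fst (C i) = snd (C (i - 1))"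
  unfolding complete_curve_def by (metis diff_add_cancel)

lemma folding_curve_path:
  assumes "complete_folding_curve C"
  shows "folding_path (\<lambda>i. snd (C i)) (assoc_seq C)"
proof -
  have C: "complete_curve C" "complete_folding_seq (assoc_seq C)"
    using assms unfolding complete_folding_curve_def by auto
  have "is_segment (snd (C i), snd (C (i + 1)))" for i
    using C(1) curve_step[OF C(1), of "i + 1"] unfolding complete_curve_def is_segment_def dir_def
    by (metis fst_conv snd_conv)
  moreover have "snd (C (i + 1)) - snd (C i) = rot (assoc_seq C i) (snd (C i) - snd (C (i - 1)))" for i
    using curve_step[OF C(1), of "i + 1"] curve_step[OF C(1), of i] curve_turn[OF C(1), of i] by simp
  ultimately show ?thesis using C(2) unfolding folding_path_def by blast
qed

lemma folding_pathD:
  assumes "folding_path P a"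
  shows "complete_folding_seq a" "is_segment (P i, P (i + 1))"
    "P (i + 1) - P i = rot (a i) (P i - P (i - 1))" "a i = 1 \<or> a i = - 1"
  using assms complete_folding_values unfolding folding_path_def by blast+

text \<open>The turns \<open>s\<close> at \<open>p1\<close> and \<open>- s\<close> at
  \<open>p3\<close> cancel: with \<open>d = p1 - p0\<close>, the long steps are
  \<open>d + s * i * d\<close> and \<open>t * i\<close> times the same vector.\<close>

lemma rot_fold:
  assumes "s = 1 \<or> s = - 1" "p2 - p1 = rot s (p1 - p0)" "p3 - p2 = rot t (p2 - p1)"
    "p4 - p3 = rot (- s) (p3 - p2)"
  shows "p4 - p2 = rot t (p2 - p0)"
proof -
  have "p4 - p2 = rot t (p2 - p1) + rot (- s) (rot t (p2 - p1))" using assms(3,4)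
    by (metis add.commute add_diff_eq diff_add_cancel)
  also have "\<dots> = rot t ((p2 - p1) + rot (- s) (p2 - p1))" by (simp add: rot_def prod_eq_iff algebra_simps)
  also have "rot (- s) (p2 - p1) = p1 - p0" using assms(1) unfolding assms(2) by (auto simp: rot_def prod_eq_iff)
  finally show ?thesis by simp
qed

text \<open>Skipping all points of level below \<open>m\<close> gives again a folding path, with the same turns.\<close>

lemma coarse_turn:
  assumes "folding_path P a"
  shows "j \<in> E_seq m a \<Longrightarrow> P (j + 2 * 2 ^ m) - P (j + 2 ^ m) = rot (a (j + 2 ^ m)) (P (j + 2 ^ m) - P j)"
proof (induction m arbitrary: j)
  case 0
  then show ?case using folding_pathD(3)[OF assms, of "j + 1"] by (simp add: add.assoc)
next
  case (Suc m)
  note a = folding_pathD(1)[OF assms]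
  have j: "j \<in> E_seq m a" using Suc.prems E_seq_Suc_subset[OF a] by blast
  have j1: "j + 2 ^ m \<in> E_seq m a" using E_seq_add[OF a j, of 1] by simp
  have j2: "j + 2 * 2 ^ m \<in> E_seq m a" using E_seq_add[OF a j, of 2] by simp
  have "j + 2 ^ m \<notin> E_seq (Suc m) a" using E_seq_half(1)[OF a j] Suc.prems by blast
  then have "alternates_at m a (j + 2 ^ m)" using E_seq_alternates[OF a j1] by blast
  then have "a (j + 2 ^ m + 1 * 2 ^ (m + 1)) = - a (j + 2 ^ m)"
    unfolding alternates_at_def by (metis odd_one)
  then have alt: "a (j + 2 * 2 ^ m + 2 ^ m) = - a (j + 2 ^ m)" by (simp add: algebra_simps)
  have "P (j + 4 * 2 ^ m) - P (j + 2 * 2 ^ m) = rot (a (j + 2 * 2 ^ m)) (P (j + 2 * 2 ^ m) - P j)"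
  proof (rule rot_fold)
    show "a (j + 2 ^ m) = 1 \<or> a (j + 2 ^ m) = - 1" by (rule folding_pathD(4)[OF assms])
    show "P (j + 2 * 2 ^ m) - P (j + 2 ^ m) = rot (a (j + 2 ^ m)) (P (j + 2 ^ m) - P j)"
      by (rule Suc.IH[OF j])
    show "P (j + 3 * 2 ^ m) - P (j + 2 * 2 ^ m) = rot (a (j + 2 * 2 ^ m)) (P (j + 2 * 2 ^ m) - P (j + 2 ^ m))"
      using Suc.IH[OF j1] by (simp add: algebra_simps)
    show "P (j + 4 * 2 ^ m) - P (j + 3 * 2 ^ m) = rot (- a (j + 2 ^ m)) (P (j + 3 * 2 ^ m) - P (j + 2 * 2 ^ m))"
      using Suc.IH[OF j2] unfolding alt by (simp add: algebra_simps)
  qed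
  then show ?case by (simp add: algebra_simps)
qed

lemma coarse_step_split:
  assumes "folding_path P a" "j \<in> E_seq m a"
  shows "P (j + 2 ^ Suc m) - P j = (P (j + 2 ^ m) - P j) + rot (a (j + 2 ^ m)) (P (j + 2 ^ m) - P j)"
  using coarse_turn[OF assms] by (simp flip: coarse_turn[OF assms])

text \<open>Each level multiplies the step by \<open>1 + i\<close> or \<open>1 - i\<close>, so the
  step is a unit times \<open>(1 + i) ^ m\<close>.\<close>

lemma coarse_step_Lam:
  assumes "folding_path P a"
  shows "j \<in> E_seq m a \<Longrightarrow> P (j + 2 ^ m) - P j \<in> Lam m \<and> P (j + 2 ^ m) - P j \<notin> Lam (Suc m)"
proof (induction m arbitrary: j)
  case 0
  have "is_segment (P j, P (j + 1))" by (rule folding_pathD(2)[OF assms])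
  from segment_notin_Lam[OF this] show ?case by (simp add: Lam_0 dir_def)
next
  case (Suc m)
  then have j: "j \<in> E_seq m a" using E_seq_Suc_subset[OF folding_pathD(1)[OF assms]] by blast
  show ?case unfolding coarse_step_split[OF assms j]
    using Suc.IH[OF j] Lam_turn[OF folding_pathD(4)[OF assms]] by blast
qed

lemma coarse_points:
  assumes "folding_path P a" "j \<in> E_seq m a"
  shows "P (j + k * 2 ^ m) - P j \<in> Lam m \<and> (P (j + k * 2 ^ m) - P j \<in> Lam (Suc m) \<longleftrightarrow> even k)"
proof (induction k rule: int_induct[where k = 0])
  case base
  then show ?case by (simp add: Lam_zero)
next
  case (step1 i)
  let ?s = "P (j + i * 2 ^ m + 2 ^ m) - P (j + i * 2 ^ m)"
  have *: "?s \<in> Lam m \<and> ?s \<notin> Lam (Suc m)"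
    using coarse_step_Lam[OF assms(1) E_seq_add[OF folding_pathD(1)[OF assms(1)] assms(2)]] .
  have eq: "P (j + (i + 1) * 2 ^ m) - P j = ?s + (P (j + i * 2 ^ m) - P j)" by (simp add: algebra_simps)
  show ?case unfolding eq using * step1 Lam_add_odd[of ?s m "P (j + i * 2 ^ m) - P j"] by simp
next
  case (step2 i)
  let ?s = "P (j + (i - 1) * 2 ^ m + 2 ^ m) - P (j + (i - 1) * 2 ^ m)"
  have *: "- ?s \<in> Lam m \<and> - ?s \<notin> Lam (Suc m)"
    using coarse_step_Lam[OF assms(1) E_seq_add[OF folding_pathD(1)[OF assms(1)] assms(2)]]
    unfolding Lam_minus .
  have eq: "P (j + (i - 1) * 2 ^ m) - P j = - ?s + (P (j + i * 2 ^ m) - P j)" by (simp add: algebra_simps)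
  show ?case unfolding eq using * step2 Lam_add_odd[of "- ?s" m "P (j + i * 2 ^ m) - P j"] by simp
qed

text \<open>The induction halves both sides at once: the parity of \<open>k\<close> in
  \<open>j + k * 2 ^ m\<close> decides membership in \<open>E_seq (Suc m)\<close> and, by
  \<open>coarse_points\<close>, in \<open>Lam (Suc m)\<close>.\<close>

lemma E_seq_point_iff:
  assumes "folding_path P a"
  shows "j \<in> E_seq m a \<Longrightarrow> i \<in> E_seq m a \<longleftrightarrow> P i - P j \<in> Lam m"
proof (induction m)
  case 0
  then show ?case using E_seq_0[OF folding_pathD(1)[OF assms]] by (simp add: Lam_0)
next
  case (Suc m)
  note a = folding_pathD(1)[OF assms]
  have j: "j \<in> E_seq m a" using Suc.prems E_seq_Suc_subset[OF a] by blast
  show ?case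
  proof (cases "i \<in> E_seq m a")
    case True
    then have "2 ^ m dvd i - j" using E_seq_iff[OF a j] by blast
    then obtain k where "i - j = 2 ^ m * k" by (rule dvdE)
    then have k: "i = j + k * 2 ^ m" by (simp add: algebra_simps)
    have "i \<in> E_seq (Suc m) a \<longleftrightarrow> even k"
      using E_seq_iff[OF a Suc.prems, of i] by (simp add: k)
    then show ?thesis using coarse_points[OF assms j, of k] unfolding k by blast
  next
    case False
    then show ?thesis using Suc.IH[OF j] Lam_Suc_subset E_seq_Suc_subset[OF a] by blast
  qed
qed

lemma E_curve_eq:
  assumes "complete_folding_curve C" "j \<in> E_seq m (assoc_seq C)"
  shows "E_curve m C = {x. x - snd (C j) \<in> Lam m}"
proof -
  note p = folding_curve_path[OF assms(1)]
  define i where "i = (SOME i. i \<in> E_seq m (assoc_seq C))"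
  have "i \<in> E_seq m (assoc_seq C)" unfolding i_def using assms(2) by (rule someI)
  then have *: "snd (C i) - snd (C j) \<in> Lam m" using E_seq_point_iff[OF p assms(2)] by simp
  have "E_curve m C = {snd (C i) + l | l. l \<in> Lam m}" unfolding E_curve_def i_def Let_def ..
  also have "\<dots> = {x. x - snd (C j) \<in> Lam m}"
  proof (intro Collect_cong iffI)
    fix x assume "\<exists>l. x = snd (C i) + l \<and> l \<in> Lam m"
    then obtain l where l: "x = snd (C i) + l" "l \<in> Lam m" by blast
    have "x - snd (C j) = l + (snd (C i) - snd (C j))" using l(1) by simp
    then show "x - snd (C j) \<in> Lam m" using Lam_add[OF l(2) *] by (simp only:)
  next
    fix x assume "x - snd (C j) \<in> Lam m"
    from Lam_diff[OF this *] have "x - snd (C i) \<in> Lam m" by simp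
    then show "\<exists>l. x = snd (C i) + l \<and> l \<in> Lam m" by (intro exI[of _ "x - snd (C i)"]) simp
  qed
  finally show ?thesis .
qed

lemma E_curve_point_iff:
  assumes "complete_folding_curve C"
  shows "snd (C i) \<in> E_curve m C \<longleftrightarrow> i \<in> E_seq m (assoc_seq C)"
proof -
  note p = folding_curve_path[OF assms]
  obtain j where j: "j \<in> E_seq m (assoc_seq C)" using E_seq_nonempty[OF folding_pathD(1)[OF p]] by blast
  show ?thesis using E_seq_point_iff[OF p j] by (simp add: E_curve_eq[OF assms j])
qed

subsection \<open>A folding path covers arbitrarily large disks\<close>

definition traverses :: "(int \<Rightarrow> point) \<Rightarrow> point \<Rightarrow> point \<Rightarrow> bool" where
  "traverses P u v \<longleftrightarrow> (\<exists>i. {P i, P (i + 1)} = {u, v})"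

lemma traverses_commute: "traverses P u v \<longleftrightarrow> traverses P v u"
  by (simp add: traverses_def insert_commute)

lemma traversesI: "traverses P (P i) (P (i + 1))"
  unfolding traverses_def by blast

text \<open>The vertices at even offsets from \<open>e\<close> differ by multiples of
  \<open>1 + i\<close>; \<open>P'\<close> is the quotient.\<close>

lemma derived_path:
  assumes "folding_path P a" "derived_from e a"
  obtains P' where "folding_path P' (\<lambda>i. a (e + 2 * i))" "\<forall>i. P (e + 2 * i) = P e + spread (P' i)"
proof -
  note a = folding_pathD(1)[OF assms(1)]
  have c: "complete_folding_seq (\<lambda>i. a (e + 2 * i))" using assms(2) unfolding derived_from_def by blast
  have E1: "e + 2 * i \<in> E_seq 1 a" for i
    using E_seq_Suc[OF a assms(2), of _ 0] E_seq_0[OF c] by simp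
  have "\<exists>q. P (e + 2 * i) = P e + spread q" for i
  proof -
    have "P (e + 2 * i) - P e \<in> Lam (Suc 0)"
      using E_seq_point_iff[OF assms(1) E1[of 0], of "e + 2 * i"] E1[of i] by simp
    then obtain q where "P (e + 2 * i) - P e = spread q" by (auto simp: Lam_Suc)
    then have "P (e + 2 * i) = P e + spread q" by (simp add: algebra_simps)
    then show ?thesis by blast
  qed
  then obtain P' where P': "\<And>i. P (e + 2 * i) = P e + spread (P' i)" by metis
  have d: "spread (P' j - P' i) = P (e + 2 * j) - P (e + 2 * i)" for i j
    by (simp add: P' spread_diff)
  have turn: "P' (i + 1) - P' i = rot (a (e + 2 * i)) (P' i - P' (i - 1))" for i
  proof -
    have "P (e + 2 * (i + 1)) - P (e + 2 * i) = rot (a (e + 2 * i)) (P (e + 2 * i) - P (e + 2 * (i - 1)))"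
      using coarse_turn[OF assms(1) E1[of "i - 1"]] by (simp add: algebra_simps)
    then have "spread (P' (i + 1) - P' i) = spread (rot (a (e + 2 * i)) (P' i - P' (i - 1)))"
      unfolding spread_rot d .
    then show ?thesis by (simp only: spread_inject)
  qed
  moreover have "is_segment (P' i, P' (i + 1))" for i
  proof -
    let ?v = "P (e + 2 * i + 1) - P (e + 2 * i)"
    have "is_segment (P (e + 2 * i), P (e + 2 * i + 1))" by (rule folding_pathD(2)[OF assms(1)])
    then have v: "?v \<in> {(1, 0), (-1, 0), (0, 1), (0, -1)}" by (simp add: is_segment_def dir_def)
    have "e + 2 * i \<in> E_seq 0 a" using E_seq_0[OF a] by simp
    from coarse_step_split[OF assms(1) this]
    have "spread (P' (i + 1) - P' i) = ?v + rot (a (e + 2 * i + 1)) ?v"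
      unfolding d by (simp add: algebra_simps)
    \<comment> \<open>\<open>spread\<close> of this step is \<open>?v\<close> times
      \<open>1 + i\<close> or \<open>1 - i\<close>, so the step is \<open>?v\<close> times a
      unit.\<close>
    then have "P' (i + 1) - P' i \<in> {(1, 0), (-1, 0), (0, 1), (0, -1)}"
      using v folding_pathD(4)[OF assms(1), of "e + 2 * i + 1"]
      by (auto simp: spread_def rot_def prod_eq_iff)
    then show ?thesis by (simp add: is_segment_def dir_def)
  qed
  ultimately have "folding_path P' (\<lambda>i. a (e + 2 * i))" using c unfolding folding_path_def by blast
  then show ?thesis using P' that by blast
qed

text \<open>Each step of the derived path is the diagonal of a unit square, and the path itself runs
  along one of the two halves of the boundary of that square. As the turns at the skipped
  corners alternate, ascending diagonals always use the corner whose abscissa has a fixed parity,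
  and descending diagonals the other one.\<close>

lemma derived_corner:
  assumes "folding_path P a"
  obtains P' a' q \<tau> where "folding_path P' a'"
    "\<forall>u v. traverses P' u v \<longrightarrow> (\<exists>c. traverses P (q + spread u) c \<and> traverses P c (q + spread v) \<and>
       (c = (fst (q + spread u), snd (q + spread v)) \<or> c = (fst (q + spread v), snd (q + spread u))) \<and>
       (fst (spread v) - fst (spread u) = snd (spread v) - snd (spread u) \<longleftrightarrow> even (fst c + \<tau>)))"
proof -
  note a = folding_pathD(1)[OF assms]
  obtain e where e: "derived_from e a" using complete_folding_derived[OF a] .
  obtain P' where P': "folding_path P' (\<lambda>i. a (e + 2 * i))" "\<forall>i. P (e + 2 * i) = P e + spread (P' i)"
    by (rule derived_path[OF assms e])
  define y where "y i = P (e + 2 * i + 1)" for i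
  define v where "v i = y i - P (e + 2 * i)" for i
  define s where "s i = a (e + 2 * i + 1)" for i
  have seg: "is_segment (P (e + 2 * i), y i)" for i
    unfolding y_def by (rule folding_pathD(2)[OF assms])
  have unit: "v i \<in> {(1, 0), (-1, 0), (0, 1), (0, -1)}" for i
    using seg[of i] by (simp add: is_segment_def dir_def v_def)
  have s1: "s i = 1 \<or> s i = - 1" for i unfolding s_def by (rule folding_pathD(4)[OF assms])
  have sS: "s (i + 1) = - s i" for i
  proof -
    have "odd (e + 2 * i + 1 - e)" by simp
    then have "a (e + 2 * i + 1 + 2) = - a (e + 2 * i + 1)" using e unfolding derived_from_def by blast
    then show ?thesis by (simp add: s_def algebra_simps)
  qed
  have mid: "P (e + 2 * i + 2) - y i = rot (s i) (v i)" for i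
    using folding_pathD(3)[OF assms, of "e + 2 * i + 1"] by (simp add: y_def v_def s_def algebra_simps)
  have vS: "v (i + 1) = rot (a (e + 2 * i + 2)) (rot (s i) (v i))" for i
    using folding_pathD(3)[OF assms, of "e + 2 * i + 2"] mid[of i] by (simp add: y_def v_def algebra_simps)
  have yS: "y (i + 1) - y i = rot (s i) (v i) + v (i + 1)" for i
    using mid[of i] by (simp add: v_def algebra_simps)
  have hor: "fst (v (i + 1)) = 0 \<longleftrightarrow> fst (v i) = 0" for i
    using vS[of i] unit[of i] s1[of i] folding_pathD(4)[OF assms, of "e + 2 * i + 2"]
    by (auto simp: rot_def)
  have hor0: "fst (v i) = 0 \<longleftrightarrow> fst (v 0) = 0" for i
  proof (induction i rule: int_induct[where k = 0])
    case (step2 i)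
    then show ?case using hor[of "i - 1"] by simp
  qed (use hor in simp_all)
  \<comment> \<open>From one corner to the next the path makes one horizontal and one vertical step,
    so the parity of the abscissa flips together with the sign of \<open>s\<close>.\<close>
  have yS': "odd (fst (y (i + 1)) - fst (y i))" for i
  proof -
    have "fst (y (i + 1)) - fst (y i) = fst (rot (s i) (v i)) + fst (v (i + 1))"
      using yS[of i] by (metis fst_add fst_diff)
    then show ?thesis using unit[of i] unit[of "i + 1"] hor[of i] s1[of i] by (auto simp: rot_def)
  qed
  have par: "even (fst (y i) - fst (y 0)) \<longleftrightarrow> s i = s 0" for i
  proof (induction i rule: int_induct[where k = 0])
    case (step1 i)
    then show ?case using yS'[of i] sS[of i] s1[of i] s1[of 0] by auto
  next
    case (step2 i)
    then show ?case using yS'[of "i - 1"] sS[of "i - 1"] s1[of "i - 1"] s1[of 0] by auto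
  qed simp
  \<comment> \<open>\<open>\<kappa>\<close> is the turn that makes the diagonal ascending: left
    after a horizontal step, right after a vertical one; all \<open>v i\<close> share their axis.
    \<open>\<tau>\<close> shifts the parity so that the corners with turn \<open>\<kappa>\<close>
    are those with \<open>fst (y i) + \<tau>\<close> even.\<close>
  define \<kappa> :: int where "\<kappa> = (if fst (v 0) = 0 then - 1 else 1)"
  define \<tau> where "\<tau> = fst (y 0) + (if s 0 = \<kappa> then 0 else 1)"
  have diag: "fst (v i + rot (s i) (v i)) = snd (v i + rot (s i) (v i)) \<longleftrightarrow> even (fst (y i) + \<tau>)" for i
  proof -
    have "fst (v i + rot (s i) (v i)) = snd (v i + rot (s i) (v i)) \<longleftrightarrow> s i = \<kappa>"
      using unit[of i] s1[of i] hor0[of i] unfolding \<kappa>_def by (auto simp: rot_def)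
    also have "\<dots> \<longleftrightarrow> even (fst (y i) + \<tau>)"
    proof -
      have "\<kappa> = 1 \<or> \<kappa> = - 1" unfolding \<kappa>_def by simp
      moreover have "even (fst (y i) + \<tau>) \<longleftrightarrow> (even (fst (y i) - fst (y 0)) \<longleftrightarrow> s 0 = \<kappa>)"
        unfolding \<tau>_def by simp
      ultimately show ?thesis using par[of i] s1[of i] s1[of 0] by auto
    qed
    finally show ?thesis .
  qed
  have corner: "traverses P (P e + spread (P' i)) (y i) \<and> traverses P (y i) (P e + spread (P' (i + 1))) \<and>
       (y i = (fst (P e + spread (P' i)), snd (P e + spread (P' (i + 1)))) \<or>
        y i = (fst (P e + spread (P' (i + 1))), snd (P e + spread (P' i)))) \<and>
       (fst (spread (P' (i + 1))) - fst (spread (P' i)) = snd (spread (P' (i + 1))) - snd (spread (P' i))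
         \<longleftrightarrow> even (fst (y i) + \<tau>))" for i
  proof -
    have A: "P e + spread (P' i) = P (e + 2 * i)" "P e + spread (P' (i + 1)) = P (e + 2 * i + 2)"
      using P'(2)[rule_format, of i] P'(2)[rule_format, of "i + 1"] by (simp_all add: algebra_simps)
    have "spread (P' (i + 1)) - spread (P' i) = P (e + 2 * i + 2) - P (e + 2 * i)"
      using A by (metis add_diff_cancel_left)
    also have "\<dots> = v i + rot (s i) (v i)" using mid[of i] by (simp add: v_def algebra_simps)
    finally have D: "fst (spread (P' (i + 1))) - fst (spread (P' i)) = fst (v i + rot (s i) (v i))"
      "snd (spread (P' (i + 1))) - snd (spread (P' i)) = snd (v i + rot (s i) (v i))"
      by (metis fst_diff, metis snd_diff)
    have "traverses P (P (e + 2 * i)) (y i)" "traverses P (y i) (P (e + 2 * i + 2))"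
      using traversesI[of P "e + 2 * i"] traversesI[of P "e + 2 * i + 1"] by (simp_all add: y_def add.assoc)
    moreover have "y i = (fst (P (e + 2 * i)), snd (P (e + 2 * i + 2))) \<or>
        y i = (fst (P (e + 2 * i + 2)), snd (P (e + 2 * i)))"
      using mid[of i] unit[of i] unfolding v_def by (auto simp: rot_def prod_eq_iff)
    ultimately show ?thesis unfolding A D using diag[of i] by blast
  qed
  show ?thesis
  proof (rule that[OF P'(1)], intro allI impI)
    fix u w assume "traverses P' u w"
    then obtain i where i: "{P' i, P' (i + 1)} = {u, w}" unfolding traverses_def by blast
    then consider "u = P' i" "w = P' (i + 1)" | "w = P' i" "u = P' (i + 1)"
      by (auto simp: doubleton_eq_iff)
    then show "\<exists>c. traverses P (P e + spread u) c \<and> traverses P c (P e + spread w) \<and>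
       (c = (fst (P e + spread u), snd (P e + spread w)) \<or> c = (fst (P e + spread w), snd (P e + spread u))) \<and>
       (fst (spread w) - fst (spread u) = snd (spread w) - snd (spread u) \<longleftrightarrow> even (fst c + \<tau>))"
    proof cases
      case 1
      then show ?thesis using corner[of i] by blast
    next
      case 2
      have "fst (spread w) - fst (spread u) = snd (spread w) - snd (spread u) \<longleftrightarrow>
        fst (spread u) - fst (spread w) = snd (spread u) - snd (spread w)" by linarith
      then show ?thesis using corner[of i] traverses_commute 2 by metis
    qed
  qed
qed


section \<open>Inflation of edge patterns\<close>

fun edge_covered :: "(int \<Rightarrow> point) \<Rightarrow> point \<Rightarrow> bool \<times> int \<times> int \<Rightarrow> bool" where
  "edge_covered P p (h, x, y) = traverses P (p + (x, y)) (p + (if h then (x + 1, y) else (x, y + 1)))"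

text \<open>An edge is coded by its axis and its left or lower end relative to a base point. Under
  \<open>spread\<close> it becomes the diagonal of a unit square, and the list gives the two sides
  on which the finer path runs. The bit \<open>b\<close> records, as seen from the base point, which
  corner parity is used. Coverage thus becomes evaluation of finite lists.\<close>

fun inflate :: "bool \<Rightarrow> bool \<times> int \<times> int \<Rightarrow> (bool \<times> int \<times> int) list" where
  "inflate b (True, x, y) =
     (if even (x - y) = b then [(False, x - y, x + y), (True, x - y, x + y + 1)]
      else [(True, x - y, x + y), (False, x - y + 1, x + y)])"
| "inflate b (False, x, y) =
     (if even (x - y) = b then [(True, x - y - 1, x + y), (False, x - y - 1, x + y)]
      else [(False, x - y, x + y), (True, x - y - 1, x + y + 1)])"

definition inflates :: "(int \<Rightarrow> point) \<Rightarrow> point \<Rightarrow> (int \<Rightarrow> point) \<Rightarrow> point \<Rightarrow> bool \<Rightarrow> bool" where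
  "inflates P' p' P p b \<longleftrightarrow>
     (\<forall>e. edge_covered P' p' e \<longrightarrow> (\<forall>f\<in>set (inflate b e). edge_covered P p f))"

text \<open>The bit depends on the path and on the parity of the new base point. It cannot be
  prescribed, so the case check has to cope with every sequence of bits.\<close>

lemma derived_inflates:
  assumes "folding_path P a"
  obtains P' a' where "folding_path P' a'" "\<And>p'. \<exists>p b. inflates P' p' P p b"
proof -
  obtain P' a' q \<tau> where P': "folding_path P' a'" and
    corner: "\<forall>u v. traverses P' u v \<longrightarrow> (\<exists>c. traverses P (q + spread u) c \<and> traverses P c (q + spread v) \<and>
       (c = (fst (q + spread u), snd (q + spread v)) \<or> c = (fst (q + spread v), snd (q + spread u))) \<and>
       (fst (spread v) - fst (spread u) = snd (spread v) - snd (spread u) \<longleftrightarrow> even (fst c + \<tau>)))"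
    by (rule derived_corner[OF assms])
  have "inflates P' p' P (q + spread p') (even (fst (q + spread p') + \<tau>))" for p'
    unfolding inflates_def
  proof (intro allI impI)
    fix e assume cov: "edge_covered P' p' e"
    obtain h x y where e: "e = (h, x, y)" by (cases e) auto
    let ?p = "q + spread p'"
    show "\<forall>f\<in>set (inflate (even (fst ?p + \<tau>)) e). edge_covered P ?p f"
    proof (cases h)
      case True
      have "traverses P' (p' + (x, y)) (p' + (x + 1, y))" using cov by (simp add: e True)
      from corner[rule_format, OF this] obtain c where
        c: "traverses P (q + spread (p' + (x, y))) c" "traverses P c (q + spread (p' + (x + 1, y)))"
        "c = (fst (q + spread (p' + (x, y))), snd (q + spread (p' + (x + 1, y)))) \<or>
         c = (fst (q + spread (p' + (x + 1, y))), snd (q + spread (p' + (x, y))))"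
        "fst (spread (p' + (x + 1, y))) - fst (spread (p' + (x, y))) =
         snd (spread (p' + (x + 1, y))) - snd (spread (p' + (x, y))) \<longleftrightarrow> even (fst c + \<tau>)" by blast
      have A: "q + spread (p' + (x, y)) = ?p + (x - y, x + y)"
        "q + spread (p' + (x + 1, y)) = ?p + (x - y + 1, x + y + 1)"
        by (simp_all add: spread_def prod_eq_iff)
      have ev: "even (fst c + \<tau>)" using c(4) by (simp add: spread_def)
      from c(3) consider "c = ?p + (x - y, x + y + 1)" | "c = ?p + (x - y + 1, x + y)"
        unfolding A by (auto simp: prod_eq_iff)
      then show ?thesis
      proof cases
        case 1
        then have "even (x - y) = even (fst ?p + \<tau>)" using ev by (auto simp: algebra_simps)
        then show ?thesis using c(1,2) unfolding A 1 by (simp add: e True)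
      next
        case 2
        then have "even (x - y) \<noteq> even (fst ?p + \<tau>)" using ev by (auto simp: algebra_simps)
        then show ?thesis using c(1,2) unfolding A 2 by (auto simp: e True)
      qed
    next
      case False
      have "traverses P' (p' + (x, y)) (p' + (x, y + 1))" using cov by (simp add: e False)
      from corner[rule_format, OF this] obtain c where
        c: "traverses P (q + spread (p' + (x, y))) c" "traverses P c (q + spread (p' + (x, y + 1)))"
        "c = (fst (q + spread (p' + (x, y))), snd (q + spread (p' + (x, y + 1)))) \<or>
         c = (fst (q + spread (p' + (x, y + 1))), snd (q + spread (p' + (x, y))))"
        "fst (spread (p' + (x, y + 1))) - fst (spread (p' + (x, y))) =
         snd (spread (p' + (x, y + 1))) - snd (spread (p' + (x, y))) \<longleftrightarrow> even (fst c + \<tau>)" by blast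
      have A: "q + spread (p' + (x, y)) = ?p + (x - y, x + y)"
        "q + spread (p' + (x, y + 1)) = ?p + (x - y - 1, x + y + 1)"
        by (simp_all add: spread_def prod_eq_iff)
      have od: "odd (fst c + \<tau>)" using c(4) by (simp add: spread_def)
      from c(3) consider "c = ?p + (x - y, x + y + 1)" | "c = ?p + (x - y - 1, x + y)"
        unfolding A by (auto simp: prod_eq_iff)
      then show ?thesis
      proof cases
        case 1
        then have "even (x - y) \<noteq> even (fst ?p + \<tau>)" using od by (auto simp: algebra_simps)
        then show ?thesis using c(1,2) unfolding A 1 by (auto simp: e False traverses_commute)
      next
        case 2
        then have "even (x - y) = even (fst ?p + \<tau>)" using od by (auto simp: algebra_simps)
        then show ?thesis using c(1,2) unfolding A 2 by (auto simp: e False traverses_commute)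
      qed
    qed
  qed
  then show ?thesis using that[OF P'] by blast
qed

lemma inflates_list:
  assumes "inflates P' p' P p b" "\<forall>e\<in>set L. edge_covered P' p' e"
  shows "\<forall>f\<in>set (concat (map (inflate b) L)). edge_covered P p f"
  using assms unfolding inflates_def by (simp only: set_concat set_map) blast

text \<open>A unit edge is covered as soon as the diagonals of both adjacent unit squares are steps of
  the derived path, because only one of these two diagonals can avoid it.\<close>

lemma inflates_edge:
  assumes "inflates P' p' P p b"
  shows "edge_covered P' p' (True, x, y) \<Longrightarrow> edge_covered P' p' (False, x, y - 1) \<Longrightarrow>
      edge_covered P p (True, x - y, x + y)"
    and "edge_covered P' p' (False, x, y) \<Longrightarrow> edge_covered P' p' (True, x - 1, y) \<Longrightarrow>
      edge_covered P p (True, x - y - 1, x + y)"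
    and "edge_covered P' p' (True, x, y) \<Longrightarrow> edge_covered P' p' (False, x, y) \<Longrightarrow>
      edge_covered P p (False, x - y, x + y)"
    and "edge_covered P' p' (False, x, y - 1) \<Longrightarrow> edge_covered P' p' (True, x - 1, y) \<Longrightarrow>
      edge_covered P p (False, x - y, x + y - 1)"
proof -
  have H: "\<forall>f\<in>set (inflate b (True, x, y)). edge_covered P p f" if "edge_covered P' p' (True, x, y)" for x y
    using assms that unfolding inflates_def by blast
  have V: "\<forall>f\<in>set (inflate b (False, x, y)). edge_covered P p f" if "edge_covered P' p' (False, x, y)" for x y
    using assms that unfolding inflates_def by blast
  show "edge_covered P p (True, x - y, x + y)"
    if "edge_covered P' p' (True, x, y)" "edge_covered P' p' (False, x, y - 1)"
    using H[OF that(1)] V[OF that(2)] by (auto simp: algebra_simps simp del: edge_covered.simps split: if_splits)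
  show "edge_covered P p (True, x - y - 1, x + y)"
    if "edge_covered P' p' (False, x, y)" "edge_covered P' p' (True, x - 1, y)"
    using H[OF that(2)] V[OF that(1)] by (auto simp: algebra_simps simp del: edge_covered.simps split: if_splits)
  show "edge_covered P p (False, x - y, x + y)"
    if "edge_covered P' p' (True, x, y)" "edge_covered P' p' (False, x, y)"
    using H[OF that(1)] V[OF that(2)] by (auto simp: algebra_simps simp del: edge_covered.simps split: if_splits)
  show "edge_covered P p (False, x - y, x + y - 1)"
    if "edge_covered P' p' (False, x, y - 1)" "edge_covered P' p' (True, x - 1, y)"
    using H[OF that(2)] V[OF that(1)] by (auto simp: algebra_simps simp del: edge_covered.simps split: if_splits)
qed


text \<open>The seed of the growth: the diamond of radius 1 around the base point.\<close>

definition star :: "(bool \<times> int \<times> int) list" where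
  "star = [(True, 0, 0), (True, - 1, 0), (False, 0, 0), (False, 0, - 1)]"

text \<open>\<open>g + 1\<close> and \<open>g + 3\<close> carry opposite values of \<open>a\<close>
  but equal values of \<open>s\<close>, so at one of them \<open>a\<close> agrees with
  \<open>s\<close>, and \<open>a\<close> changes sign two places later. Either the next entry
  repeats the value, or the next two entries both equal the next value of \<open>s\<close>.\<close>

lemma derived_equal_pair:
  assumes "complete_folding_seq a" "\<And>x. s (x + 1) = - s x" "\<And>x. s x = (1::int) \<or> s x = - 1"
  shows "\<exists>x. a x = s x \<and> a (x + 1) = s x"
proof -
  obtain g where g: "derived_from g a" using complete_folding_derived[OF assms(1)] .
  have alt: "a (g + 1 + 2 * k) = (if even k then a (g + 1) else - a (g + 1))" for k
    using derived_from_alternating[OF g, of "g + 1"] by simp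
  have *: "\<exists>x. a x = s x \<and> a (x + 1) = s x" if "a x = s x" "a (x + 2) = - a x" for x
  proof (cases "a (x + 1) = a x")
    case False
    then have "a (x + 1) = - s x" using that assms(3)[of x] complete_folding_values[OF assms(1), of "x + 1"] by auto
    moreover have "a (x + 1 + 1) = - s x" using that by (simp add: add.assoc)
    ultimately show ?thesis using assms(2)[of x] by metis
  qed (use that in auto)
  have s2: "s (g + 3) = s (g + 1)" using assms(2)[of "g + 1"] assms(2)[of "g + 2"] by (simp add: add.assoc)
  have a3: "a (g + 3) = - a (g + 1)" and a5: "a (g + 3 + 2) = a (g + 1)"
    using alt[of 1] alt[of 2] by (simp_all add: add.assoc)
  show ?thesis
  proof (cases "a (g + 1) = s (g + 1)")
    case True
    then show ?thesis using *[of "g + 1"] a3 by (simp add: add.assoc)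
  next
    case False
    then have "a (g + 3) = s (g + 3)"
      using a3 s2 assms(3)[of "g + 1"] complete_folding_values[OF assms(1), of "g + 1"] by auto
    then show ?thesis using *[of "g + 3"] a3 a5 by simp
  qed
qed

text \<open>Sought are five turns \<open>- s, s, s, s, - s\<close> in a row. The three middle ones
  close a unit square at \<open>P j\<close>; the outer ones make the path enter and leave that
  corner by the other two edges.\<close>

lemma exists_star:
  assumes "folding_path P a"
  shows "\<exists>p. \<forall>e\<in>set star. edge_covered P p e"
proof -
  note a = folding_pathD(1)[OF assms]
  obtain e where e: "derived_from e a" using complete_folding_derived[OF a] .
  have alt: "a (e + 2 * x + 3) = - a (e + 2 * x + 1)" for x
  proof -
    have "odd (e + 2 * x + 1 - e)" by simp
    then have "a (e + 2 * x + 1 + 2) = - a (e + 2 * x + 1)" using e unfolding derived_from_def by blast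
    then show ?thesis by (simp add: algebra_simps)
  qed
  \<comment> \<open>A turn at an odd offset equal to both its neighbours gives the three middle
    turns; the outer two then have the opposite sign by \<open>alt\<close>.\<close>
  have "\<exists>x. a (e + 2 * x) = a (e + 2 * x + 1) \<and> a (e + 2 * (x + 1)) = a (e + 2 * x + 1)"
  proof (rule derived_equal_pair)
    show "complete_folding_seq (\<lambda>x. a (e + 2 * x))" using e unfolding derived_from_def by blast
    show "a (e + 2 * (x + 1) + 1) = - a (e + 2 * x + 1)" for x using alt[of x] by (simp add: algebra_simps)
    show "a (e + 2 * x + 1) = 1 \<or> a (e + 2 * x + 1) = - 1" for x using complete_folding_values[OF a] .
  qed
  then obtain x where x: "a (e + 2 * x) = a (e + 2 * x + 1)" "a (e + 2 * x + 2) = a (e + 2 * x + 1)"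
    by (auto simp: algebra_simps)
  define j where "j = e + 2 * x - 1"
  define s where "s = a (j + 1)"
  have s: "s = 1 \<or> s = - 1" unfolding s_def by (rule folding_pathD(4)[OF assms])
  have "a j = - s" "a (j + 2) = s" "a (j + 3) = s" "a (j + 4) = - s"
    using x alt[of x] alt[of "x - 1"] unfolding s_def j_def by (simp_all add: algebra_simps)
  define d where "d = P j - P (j - 1)"
  have turn: "P (j + k + 1) - P (j + k) = rot (a (j + k)) (P (j + k) - P (j + k - 1))" for k
    by (rule folding_pathD(3)[OF assms])
  have d1: "P (j + 1) - P j = rot (- s) d" using turn[of 0] \<open>a j = - s\<close> by (simp add: d_def)
  have d2: "P (j + 2) - P (j + 1) = d"
    using turn[of 1] d1 s by (auto simp: s_def[symmetric] rot_def add.assoc)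
  have d3: "P (j + 3) - P (j + 2) = rot s d"
    using turn[of 2] d2 \<open>a (j + 2) = s\<close> by (simp add: algebra_simps)
  have d4: "P (j + 4) - P (j + 3) = - d"
    using turn[of 3] d3 \<open>a (j + 3) = s\<close> s by (auto simp: algebra_simps rot_def prod_eq_iff)
  have d5: "P (j + 5) - P (j + 4) = rot s d"
    using turn[of 4] d4 \<open>a (j + 4) = - s\<close> by (auto simp: algebra_simps rot_def prod_eq_iff)
  have P1: "P (j + 1) = P j - rot s d" using d1 by (auto simp: rot_def prod_eq_iff)
  have P4: "P (j + 4) = P j" using d1 d2 d3 d4 by (auto simp: rot_def prod_eq_iff)
  have P3: "P (j + 3) = P j + d" using P4 d4 by (auto simp: prod_eq_iff)
  have P5: "P (j + 5) = P j + rot s d" using P4 d5 by (auto simp: prod_eq_iff)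
  have P0: "P (j - 1) = P j - d" by (simp add: d_def)
  have "is_segment (P (j - 1), P (j - 1 + 1))" by (rule folding_pathD(2)[OF assms])
  then have unit: "d \<in> {(1, 0), (-1, 0), (0, 1), (0, -1)}" by (simp add: is_segment_def dir_def d_def)
  have t1: "traverses P (P j) (P j - d)"
    using traversesI[of P "j - 1"] P0 by (simp add: traverses_commute)
  have t2: "traverses P (P j) (P j - rot s d)"
    using traversesI[of P j] P1 by simp
  have t3: "traverses P (P j) (P j + d)"
    using traversesI[of P "j + 3"] P3 P4 by (simp add: traverses_commute add.assoc)
  have t4: "traverses P (P j) (P j + rot s d)"
    using traversesI[of P "j + 4"] P4 P5 by (simp add: add.assoc)
  have "traverses P (P j) (P j + u)" if "u \<in> {(1, 0), (-1, 0), (0, 1), (0, -1)}" for u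
  proof -
    have "u \<in> {d, - d, rot s d, - rot s d}" using that unit s by (auto simp: rot_def)
    then show ?thesis using t1 t2 t3 t4 by auto
  qed
  from this[of "(1, 0)"] this[of "(-1, 0)"] this[of "(0, 1)"] this[of "(0, -1)"]
  moreover have "P j + (0, 0) = P j" by (simp add: prod_eq_iff)
  ultimately have "\<forall>e\<in>set star. edge_covered P (P j) e"
    unfolding star_def list.set ball_simps edge_covered.simps by (simp add: traverses_commute)
  then show ?thesis by blast
qed

text \<open>Inflation rotates by 45 degrees, so squares and diamonds take turns. A diamond becomes a
  square whose boundary edges have a derived diagonal on one side only and may be missed; hence the
  variant \<open>open_square_covered\<close>.\<close>

definition square_covered :: "int \<Rightarrow> (int \<Rightarrow> point) \<Rightarrow> point \<Rightarrow> bool" where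
  "square_covered n P p \<longleftrightarrow>
     (\<forall>x y. - n \<le> x \<and> x < n \<and> \<bar>y\<bar> \<le> n \<longrightarrow> edge_covered P p (True, x, y)) \<and>
     (\<forall>x y. \<bar>x\<bar> \<le> n \<and> - n \<le> y \<and> y < n \<longrightarrow> edge_covered P p (False, x, y))"

definition open_square_covered :: "int \<Rightarrow> (int \<Rightarrow> point) \<Rightarrow> point \<Rightarrow> bool" where
  "open_square_covered n P p \<longleftrightarrow>
     (\<forall>x y. - n \<le> x \<and> x < n \<and> \<bar>y\<bar> < n \<longrightarrow> edge_covered P p (True, x, y)) \<and>
     (\<forall>x y. \<bar>x\<bar> < n \<and> - n \<le> y \<and> y < n \<longrightarrow> edge_covered P p (False, x, y))"

definition diamond_covered :: "int \<Rightarrow> (int \<Rightarrow> point) \<Rightarrow> point \<Rightarrow> bool" where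
  "diamond_covered r P p \<longleftrightarrow>
     (\<forall>x y. \<bar>x\<bar> + \<bar>y\<bar> \<le> r \<and> \<bar>x + 1\<bar> + \<bar>y\<bar> \<le> r \<longrightarrow> edge_covered P p (True, x, y)) \<and>
     (\<forall>x y. \<bar>x\<bar> + \<bar>y\<bar> \<le> r \<and> \<bar>x\<bar> + \<bar>y + 1\<bar> \<le> r \<longrightarrow> edge_covered P p (False, x, y))"

lemma even_sum_rotated:
  fixes x y :: int
  assumes "even (x + y)"
  obtains u v where "x = u - v" "y = u + v"
proof -
  obtain u where "x + y = 2 * u" using assms by (rule evenE)
  then have "x = u - (u - x)" "y = u + (u - x)" by auto
  then show ?thesis by (rule that)
qed

text \<open>According to the parity of the coordinate sum, the left or the right end of the edge is
  an image under \<open>spread\<close>. The two derived edges demanded are diagonals of the squares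
  above and below it.\<close>

lemma inflates_horizontal:
  assumes "inflates P' p' P p b"
    and H0: "\<And>x y. H (x - y) (x + y) \<Longrightarrow> edge_covered P' p' (True, x, y) \<and> edge_covered P' p' (False, x, y - 1)"
    and H1: "\<And>x y. H (x - y - 1) (x + y) \<Longrightarrow> edge_covered P' p' (False, x, y) \<and> edge_covered P' p' (True, x - 1, y)"
  shows "\<forall>x y. H x y \<longrightarrow> edge_covered P p (True, x, y)"
proof (intro allI impI)
  fix x y assume h: "H x y"
  show "edge_covered P p (True, x, y)"
  proof (cases "even (x + y)")
    case True
    then obtain u v where "x = u - v" "y = u + v" by (rule even_sum_rotated)
    then show ?thesis using H0[of u v] inflates_edge(1)[OF assms(1), of u v] h by blast
  next
    case False
    then have "even (x + 1 + y)" by simp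
    then obtain u v where "x + 1 = u - v" "y = u + v" by (rule even_sum_rotated)
    then have "x = u - v - 1" "y = u + v" by auto
    then show ?thesis using H1[of u v] inflates_edge(2)[OF assms(1), of u v] h by blast
  qed
qed

lemma inflates_vertical:
  assumes "inflates P' p' P p b"
    and V0: "\<And>x y. V (x - y) (x + y) \<Longrightarrow> edge_covered P' p' (True, x, y) \<and> edge_covered P' p' (False, x, y)"
    and V1: "\<And>x y. V (x - y) (x + y - 1) \<Longrightarrow> edge_covered P' p' (False, x, y - 1) \<and> edge_covered P' p' (True, x - 1, y)"
  shows "\<forall>x y. V x y \<longrightarrow> edge_covered P p (False, x, y)"
proof (intro allI impI)
  fix x y assume h: "V x y"
  show "edge_covered P p (False, x, y)"
  proof (cases "even (x + y)")
    case True
    then obtain u v where "x = u - v" "y = u + v" by (rule even_sum_rotated)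
    then show ?thesis using V0[of u v] inflates_edge(3)[OF assms(1), of u v] h by blast
  next
    case False
    then have "even (x + (y + 1))" by simp
    then obtain u v where "x = u - v" "y + 1 = u + v" by (rule even_sum_rotated)
    then have "x = u - v" "y = u + v - 1" by auto
    then show ?thesis using V1[of u v] inflates_edge(4)[OF assms(1), of u v] h by blast
  qed
qed

lemma square_inflates:
  assumes "inflates P' p' P p b" "square_covered n P' p'"
  shows "diamond_covered (2 * n) P p"
proof -
  have H: "edge_covered P' p' (True, x, y)" if "- n \<le> x" "x < n" "\<bar>y\<bar> \<le> n" for x y
    using assms(2) that unfolding square_covered_def by blast
  have V: "edge_covered P' p' (False, x, y)" if "\<bar>x\<bar> \<le> n" "- n \<le> y" "y < n" for x y
    using assms(2) that unfolding square_covered_def by blast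
  show ?thesis
    unfolding diamond_covered_def
    by (intro conjI inflates_horizontal[OF assms(1)] inflates_vertical[OF assms(1)] H V; linarith)
qed

lemma diamond_inflates:
  assumes "inflates P' p' P p b" "diamond_covered r P' p'"
  shows "open_square_covered r P p"
proof -
  have H: "edge_covered P' p' (True, x, y)" if "\<bar>x\<bar> + \<bar>y\<bar> \<le> r" "\<bar>x + 1\<bar> + \<bar>y\<bar> \<le> r" for x y
    using assms(2) that unfolding diamond_covered_def by blast
  have V: "edge_covered P' p' (False, x, y)" if "\<bar>x\<bar> + \<bar>y\<bar> \<le> r" "\<bar>x\<bar> + \<bar>y + 1\<bar> \<le> r" for x y
    using assms(2) that unfolding diamond_covered_def by blast
  show ?thesis
    unfolding open_square_covered_def
    by (intro conjI inflates_horizontal[OF assms(1)] inflates_vertical[OF assms(1)] H V; linarith)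
qed

lemma open_square_inflates:
  assumes "inflates P' p' P p b" "open_square_covered n P' p'"
  shows "diamond_covered (2 * n - 1) P p"
proof -
  have H: "edge_covered P' p' (True, x, y)" if "- n \<le> x" "x < n" "\<bar>y\<bar> < n" for x y
    using assms(2) that unfolding open_square_covered_def by blast
  have V: "edge_covered P' p' (False, x, y)" if "\<bar>x\<bar> < n" "- n \<le> y" "y < n" for x y
    using assms(2) that unfolding open_square_covered_def by blast
  show ?thesis
    unfolding diamond_covered_def
    by (intro conjI inflates_horizontal[OF assms(1)] inflates_vertical[OF assms(1)] H V; linarith)
qed


text \<open>The edges demanded by \<open>square_covered 1\<close>, listed so that their presence can
  be checked by evaluation.\<close>

definition block :: "int \<Rightarrow> int \<Rightarrow> (bool \<times> int \<times> int) list" where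
  "block x y = [(True, x - 1, y - 1), (True, x, y - 1), (True, x - 1, y), (True, x, y),
     (True, x - 1, y + 1), (True, x, y + 1), (False, x - 1, y - 1), (False, x - 1, y),
     (False, x, y - 1), (False, x, y), (False, x + 1, y - 1), (False, x + 1, y)]"

lemma block_covered:
  assumes "\<forall>e\<in>set (block u v). edge_covered P p e"
  shows "square_covered 1 P (p + (u, v))"
proof -
  have cov: "edge_covered P (p + (u, v)) (h, x, y) \<longleftrightarrow> edge_covered P p (h, u + x, v + y)" for h x y
    by (simp add: add.assoc)
  have "edge_covered P (p + (u, v)) (True, x, y)" if "- 1 \<le> x" "x < 1" "\<bar>y\<bar> \<le> 1" for x y
  proof -
    have "x = - 1 \<or> x = 0" "y = - 1 \<or> y = 0 \<or> y = 1" using that by auto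
    then show ?thesis unfolding cov using assms by (auto simp: block_def simp del: edge_covered.simps)
  qed
  moreover have "edge_covered P (p + (u, v)) (False, x, y)" if "\<bar>x\<bar> \<le> 1" "- 1 \<le> y" "y < 1" for x y
  proof -
    have "x = - 1 \<or> x = 0 \<or> x = 1" "y = - 1 \<or> y = 0" using that by auto
    then show ?thesis unfolding cov using assms by (auto simp: block_def simp del: edge_covered.simps)
  qed
  ultimately show ?thesis unfolding square_covered_def by blast
qed

fun inflate_all :: "bool list \<Rightarrow> (bool \<times> int \<times> int) list \<Rightarrow> (bool \<times> int \<times> int) list" where
  "inflate_all [] L = L"
| "inflate_all (b # bs) L = inflate_all bs (concat (map (inflate b) L))"

lemma inflate_all_append: "inflate_all (bs @ cs) L = inflate_all cs (inflate_all bs L)"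
  by (induction bs arbitrary: L) auto

lemma inflate_all_mono: "set L \<subseteq> set M \<Longrightarrow> set (inflate_all bs L) \<subseteq> set (inflate_all bs M)"
proof (induction bs arbitrary: L M)
  case (Cons b bs)
  have "set (concat (map (inflate b) L)) \<subseteq> set (concat (map (inflate b) M))" using Cons.prems by auto
  then show ?case using Cons.IH by simp
qed simp

lemma inflate_all_persistent:
  assumes "\<And>b. set L \<subseteq> set (concat (map (inflate b) L))"
  shows "set L \<subseteq> set (inflate_all bs L)"
proof (induction bs)
  case (Cons b bs)
  then show ?case using inflate_all_mono[OF assms[of b], of bs] by simp
qed simp

lemma star_persistent: "set star \<subseteq> set (inflate_all bs star)"
proof (rule inflate_all_persistent)
  show "set star \<subseteq> set (concat (map (inflate b) star))" for b
    by (cases b) (simp_all add: star_def)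
qed

lemma block_persistent: "set (block 0 0) \<subseteq> set (inflate_all bs (block 0 0))"
proof (rule inflate_all_persistent)
  show "set (block 0 0) \<subseteq> set (concat (map (inflate b) (block 0 0)))" for b
    by (cases b) (simp_all add: block_def)
qed

text \<open>Two equal bits in a row complete the block around the base point. Persistence of the
  star absorbs the earlier bits, persistence of the block the later ones.\<close>

lemma star_inflates_block_equal:
  "set (block 0 0) \<subseteq> set (inflate_all (bs @ [b, b] @ cs) star)"
proof -
  have "set (block 0 0) \<subseteq> set (inflate_all [b, b] star)"
    by (cases b) (simp_all add: star_def block_def)
  also have "\<dots> \<subseteq> set (inflate_all [b, b] (inflate_all bs star))"
    by (rule inflate_all_mono[OF star_persistent])
  finally have "set (inflate_all cs (block 0 0)) \<subseteq> set (inflate_all (bs @ [b, b] @ cs) star)"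
    unfolding inflate_all_append by (rule inflate_all_mono)
  then show ?thesis using block_persistent[of cs] by blast
qed

text \<open>With alternating bits a block is found away from the base point, already in the fivefold
  inflation of a single edge of the star. Its centre, \<open>(- 4, 2)\<close> or
  \<open>(- 4, - 2)\<close>, is confirmed by evaluation.\<close>

lemma star_inflates_block_alternating:
  "\<exists>x y. set (block x y) \<subseteq> set (inflate_all [b, \<not> b, b, \<not> b, b] star)"
proof (cases b)
  case True
  have "set (block (- 4) 2) \<subseteq> set (inflate_all [True, False, True, False, True] [(False, 0, - 1)])"
    by (simp add: block_def)
  also have "\<dots> \<subseteq> set (inflate_all [True, False, True, False, True] star)"
    by (rule inflate_all_mono) (simp add: star_def)
  finally show ?thesis using True by auto
next
  case False
  have "set (block (- 4) (- 2)) \<subseteq> set (inflate_all [False, True, False, True, False] [(True, 0, 0)])"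
    by (simp add: block_def)
  also have "\<dots> \<subseteq> set (inflate_all [False, True, False, True, False] star)"
    by (rule inflate_all_mono) (simp add: star_def)
  finally show ?thesis using False by auto
qed

text \<open>Five bits either agree in two neighbouring places or alternate throughout; five is the
  number of inflations used in the alternating case.\<close>

lemma star_inflates_block:
  assumes "length bs = 5"
  shows "\<exists>x y. set (block x y) \<subseteq> set (inflate_all bs star)"
proof -
  obtain b1 b2 b3 b4 b5 where bs: "bs = [b1, b2, b3, b4, b5]"
    using assms by (auto simp: length_Suc_conv eval_nat_numeral)
  consider "b1 = b2" | "b2 = b3" | "b3 = b4" | "b4 = b5"
    | "b2 = (\<not> b1)" "b3 = b1" "b4 = (\<not> b1)" "b5 = b1" by blast
  then show ?thesis
  proof cases
    case 1
    then show ?thesis using star_inflates_block_equal[of "[]" b1 "[b3, b4, b5]"] bs by auto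
  next
    case 2
    then show ?thesis using star_inflates_block_equal[of "[b1]" b2 "[b4, b5]"] bs by auto
  next
    case 3
    then show ?thesis using star_inflates_block_equal[of "[b1, b2]" b3 "[b5]"] bs by auto
  next
    case 4
    then show ?thesis using star_inflates_block_equal[of "[b1, b2, b3]" b4 "[]"] bs by auto
  next
    case 5
    then show ?thesis using star_inflates_block_alternating[of b1] bs by simp
  qed
qed

lemma iterated_inflates:
  assumes "folding_path P a"
  shows "\<exists>P' a'. folding_path P' a' \<and> (\<forall>p'. \<exists>p bs. length bs = n \<and>
    (\<forall>L. (\<forall>e\<in>set L. edge_covered P' p' e) \<longrightarrow> (\<forall>e\<in>set (inflate_all bs L). edge_covered P p e)))"
  using assms
proof (induction n arbitrary: P a)
  case 0
  then show ?case by (intro exI[of _ P] exI[of _ a]) auto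
next
  case (Suc n)
  from Suc.IH[OF Suc.prems] obtain P1 a1 where P1: "folding_path P1 a1" and
    I1: "\<And>p'. \<exists>p bs. length bs = n \<and>
      (\<forall>L. (\<forall>e\<in>set L. edge_covered P1 p' e) \<longrightarrow> (\<forall>e\<in>set (inflate_all bs L). edge_covered P p e))"
    by blast
  obtain P2 a2 where P2: "folding_path P2 a2" and I2: "\<And>p'. \<exists>p b. inflates P2 p' P1 p b"
    using derived_inflates[OF P1] by blast
  have "\<exists>p bs. length bs = Suc n \<and>
      (\<forall>L. (\<forall>e\<in>set L. edge_covered P2 p' e) \<longrightarrow> (\<forall>e\<in>set (inflate_all bs L). edge_covered P p e))" for p'
  proof -
    obtain p1 b where b: "inflates P2 p' P1 p1 b" using I2 by blast
    obtain p bs where bs: "length bs = n"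
      "\<And>L. (\<forall>e\<in>set L. edge_covered P1 p1 e) \<Longrightarrow> (\<forall>e\<in>set (inflate_all bs L). edge_covered P p e)"
      using I1 by blast
    have "\<forall>e\<in>set (inflate_all (b # bs) L). edge_covered P p e" if "\<forall>e\<in>set L. edge_covered P2 p' e" for L
      using bs(2)[OF inflates_list[OF b that]] by simp
    then show ?thesis using bs(1) by (intro exI[of _ p] exI[of _ "b # bs"]) auto
  qed
  then show ?case using P2 by blast
qed

lemma exists_square:
  assumes "folding_path P a"
  shows "\<exists>p. square_covered 1 P p"
proof -
  obtain P' a' where P': "folding_path P' a'" and
    I: "\<And>p'. \<exists>p bs. length bs = 5 \<and>
      (\<forall>L. (\<forall>e\<in>set L. edge_covered P' p' e) \<longrightarrow> (\<forall>e\<in>set (inflate_all bs L). edge_covered P p e))"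
    using iterated_inflates[OF assms, of 5] by blast
  obtain p' where "\<forall>e\<in>set star. edge_covered P' p' e" using exists_star[OF P'] by blast
  then obtain p bs where bs: "length bs = 5" "\<forall>e\<in>set (inflate_all bs star). edge_covered P p e"
    using I by blast
  from star_inflates_block[OF bs(1)] obtain x y where "set (block x y) \<subseteq> set (inflate_all bs star)"
    by blast
  then have "\<forall>e\<in>set (block x y). edge_covered P p e" using bs(2) by blast
  then show ?thesis using block_covered by blast
qed

text \<open>Two inflations take radius \<open>r\<close> to \<open>2 * r - 1\<close> and so double
  \<open>r - 1\<close>. The induction must start above \<open>r = 1\<close>, the radius of the star;
  inflating a block gives \<open>r = 2\<close>.\<close>

lemma exists_diamond:
  "folding_path P a \<Longrightarrow> \<exists>p. diamond_covered (2 ^ n + 1) P p"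
proof (induction n arbitrary: P a)
  case 0
  obtain P' a' where P': "folding_path P' a'" "\<And>p'. \<exists>p b. inflates P' p' P p b"
    using derived_inflates[OF 0] by blast
  obtain p' where "square_covered 1 P' p'" using exists_square[OF P'(1)] by blast
  then obtain p where "diamond_covered (2 * 1) P p" using P'(2) square_inflates by blast
  then show ?case by (intro exI[of _ p]) simp
next
  case (Suc n)
  obtain P1 a1 where P1: "folding_path P1 a1" "\<And>p'. \<exists>p b. inflates P1 p' P p b"
    using derived_inflates[OF Suc.prems] by blast
  obtain P2 a2 where P2: "folding_path P2 a2" "\<And>p'. \<exists>p b. inflates P2 p' P1 p b"
    using derived_inflates[OF P1(1)] by blast
  obtain p2 where "diamond_covered (2 ^ n + 1) P2 p2" using Suc.IH[OF P2(1)] by blast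
  then obtain p1 where "open_square_covered (2 ^ n + 1) P1 p1" using P2(2) diamond_inflates by blast
  then obtain p where "diamond_covered (2 * (2 ^ n + 1) - 1) P p" using P1(2) open_square_inflates by blast
  then show ?case by (intro exI[of _ p]) (simp add: algebra_simps)
qed

subsection \<open>Consequences of the local isomorphism property\<close>

definition shift_segment :: "point \<Rightarrow> segment \<Rightarrow> segment" where
  "shift_segment v s = (v + fst s, v + snd s)"

lemma fst_shift_segment: "fst (shift_segment v s) = v + fst s"
  and snd_shift_segment: "snd (shift_segment v s) = v + snd s"
  and dir_shift_segment: "dir (shift_segment v s) = dir s"
  and support_shift_segment: "support (shift_segment v s) = (+) v ` support s"
  by (simp_all add: shift_segment_def dir_def support_def)

lemma translate_eq: "translate v (s, e, f) = (shift_segment v s, (+) v ` e, (+) v ` f)"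
  by (cases s) (simp add: shift_segment_def)

lemma is_segment_shift: "is_segment (shift_segment v s) \<longleftrightarrow> is_segment s"
  by (simp add: is_segment_def dir_shift_segment)

lemma horizontal_shift: "horizontal (shift_segment v s) \<longleftrightarrow> horizontal s"
  by (simp add: horizontal_def dir_shift_segment)

lemma segment_eqI: "fst s = fst t \<Longrightarrow> dir s = dir t \<Longrightarrow> s = t"
  by (auto simp: dir_def prod_eq_iff)

lemma support_eq_cases:
  assumes "support s = support t"
  shows "s = t \<or> fst s = snd t \<and> snd s = fst t"
  using assms by (auto simp: support_def doubleton_eq_iff prod_eq_iff)

lemma folding_curveD:
  assumes "complete_folding_curve C"
  shows "complete_curve C" "complete_folding_seq (assoc_seq C)" "is_segment (C i)"
    "support (C i) = support (C j) \<longleftrightarrow> i = j" "fst (C i) = snd (C (i - 1))"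
    "dir (C (i + 1)) = rot (assoc_seq C i) (dir (C i))"
proof -
  show "complete_curve C" "complete_folding_seq (assoc_seq C)"
    using assms unfolding complete_folding_curve_def by auto
  then show "is_segment (C i)" "support (C i) = support (C j) \<longleftrightarrow> i = j" "fst (C i) = snd (C (i - 1))"
    "dir (C (i + 1)) = rot (assoc_seq C i) (dir (C i))"
    using curve_fst curve_turn unfolding complete_curve_def by blast+
qed

lemma covering_curve: "covering \<C> \<Longrightarrow> C \<in> \<C> \<Longrightarrow> complete_folding_curve C"
  unfolding covering_def by blast

lemma covering_edge:
  assumes "covering \<C>" "is_segment s"
  obtains C i where "C \<in> \<C>" "support (C i) = support s"
    "\<forall>D\<in>\<C>. (\<exists>k. support (D k) = support s) \<longrightarrow> same_curve C D"
proof -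
  have s: "support s \<in> unit_edges" using assms(2) unfolding unit_edges_def by blast
  have "\<forall>e\<in>unit_edges. \<exists>C\<in>\<C>. (\<exists>!i. support (C i) = e) \<and>
      (\<forall>D\<in>\<C>. (\<exists>i. support (D i) = e) \<longrightarrow> same_curve C D)"
    using assms(1) unfolding covering_def by (rule conjunct2)
  from bspec[OF this s] obtain C where C: "C \<in> \<C>" "\<exists>!i. support (C i) = support s"
    "\<forall>D\<in>\<C>. (\<exists>k. support (D k) = support s) \<longrightarrow> same_curve C D" by (elim bexE conjE)
  from C(2) obtain i where "support (C i) = support s" by (elim ex1E)
  then show ?thesis using that C(1,3) by blast
qed

text \<open>Both curves are shifts of one curve, on which a support occurs only once. A shared
  support therefore aligns them in index and orientation.\<close>

lemma covering_unique:
  assumes "covering \<C>" "C \<in> \<C>" "D \<in> \<C>" "support (C i) = support (D j)"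
  shows "D (j + k) = C (i + k)"
proof -
  note c = covering_curve[OF assms(1,2)]
  obtain B where "\<forall>D\<in>\<C>. (\<exists>k. support (D k) = support (C i)) \<longrightarrow> same_curve B D"
    using covering_edge[OF assms(1) folding_curveD(3)[OF c]] by metis
  then have "same_curve B C" "same_curve B D" using assms(2,3,4) by (metis, metis)
  then obtain m n where m: "\<And>k. C k = B (k + m)" and n: "\<And>k. D k = B (k + n)"
    unfolding same_curve_def by blast
  have D: "D k = C (k + (n - m))" for k unfolding m n by (simp add: algebra_simps)
  have "support (C i) = support (C (j + (n - m)))" using assms(4) D by simp
  then have "i = j + (n - m)" using folding_curveD(4)[OF c] by blast
  then have "j + k + (n - m) = i + k" by simp
  then show ?thesis unfolding D by (rule arg_cong)
qed

lemma horizontal_turn: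
  assumes "complete_folding_curve C"
  shows "horizontal (C (i + 1)) \<longleftrightarrow> \<not> horizontal (C i)" "vertical (C i) \<longleftrightarrow> \<not> horizontal (C i)"
  using folding_curveD(3)[OF assms, of i] folding_curveD(6)[OF assms, of i]
    complete_folding_values[OF folding_curveD(2)[OF assms], of i]
  by (auto simp: horizontal_def vertical_def is_segment_def rot_def)

lemma horizontal_even_steps:
  assumes "complete_folding_curve C"
  shows "horizontal (C (i + 2 * k)) \<longleftrightarrow> horizontal (C i)"
proof (induction k rule: int_induct[where k = 0])
  case (step1 k)
  then show ?case using horizontal_turn(1)[OF assms, of "i + 2 * k"]
      horizontal_turn(1)[OF assms, of "i + 2 * k + 1"] by (simp add: algebra_simps)
next
  case (step2 k)
  then show ?case using horizontal_turn(1)[OF assms, of "i + 2 * k - 2"]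
      horizontal_turn(1)[OF assms, of "i + 2 * k - 1"] by (simp add: algebra_simps)
qed simp

lemma horizontal_E1:
  assumes "complete_folding_curve C" "i \<in> E_seq 1 (assoc_seq C)" "j \<in> E_seq 1 (assoc_seq C)"
  shows "horizontal (C i) \<longleftrightarrow> horizontal (C j)"
proof -
  have "even (i - j)" using E_seq_iff[OF folding_curveD(2)[OF assms(1)] assms(3), of i] assms(2) by simp
  then obtain k where "i = j + 2 * k" by (rule even_diffE)
  then show ?thesis using horizontal_even_steps[OF assms(1)] by simp
qed

lemma type_iff:
  assumes "complete_folding_curve C" "i \<in> E_seq 1 (assoc_seq C)"
  shows "type_H C \<longleftrightarrow> horizontal (C i)" "type_V C \<longleftrightarrow> \<not> horizontal (C i)"
  using horizontal_E1[OF assms(1) _ assms(2)] assms(2) horizontal_turn(2)[OF assms(1)]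
  unfolding type_H_def type_V_def by blast+

lemma horizontal_iff:
  assumes "complete_folding_curve C"
  shows "type_H C \<Longrightarrow> horizontal (C i) \<longleftrightarrow> i \<in> E_seq 1 (assoc_seq C)"
    and "type_V C \<Longrightarrow> horizontal (C i) \<longleftrightarrow> i \<notin> E_seq 1 (assoc_seq C)"
proof -
  note a = folding_curveD(2)[OF assms]
  have "i \<in> E_seq 0 (assoc_seq C)" using E_seq_0[OF a] by simp
  then have "i + 1 \<in> E_seq 1 (assoc_seq C) \<longleftrightarrow> i \<notin> E_seq 1 (assoc_seq C)"
    using E_seq_half(1)[OF a, of i 0] by simp
  then show "type_H C \<Longrightarrow> horizontal (C i) \<longleftrightarrow> i \<in> E_seq 1 (assoc_seq C)"
    "type_V C \<Longrightarrow> horizontal (C i) \<longleftrightarrow> i \<notin> E_seq 1 (assoc_seq C)"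
    using type_iff[OF assms, of i] type_iff[OF assms, of "i + 1"] horizontal_turn(1)[OF assms, of i] by blast+
qed

lemma assoc_seq_shift:
  assumes "D j = shift_segment v (C i)" "D (j + 1) = shift_segment v (C (i + 1))"
  shows "assoc_seq D j = assoc_seq C i"
  using assms by (simp add: assoc_seq_def left_turn_def dir_shift_segment)

lemma E_seq_ex_small:
  assumes "complete_folding_seq a"
  obtains x where "x \<in> E_seq n a" "0 \<le> x" "x < 2 ^ n"
proof -
  obtain y where y: "y \<in> E_seq n a" using E_seq_nonempty[OF assms] by blast
  have "2 ^ n dvd y mod 2 ^ n - y" by (simp add: mod_eq_dvd_iff[symmetric])
  then have "y mod 2 ^ n \<in> E_seq n a" using E_seq_iff[OF assms y] by blast
  then show ?thesis using that by simp
qed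

lemma diamond_traverses:
  assumes "diamond_covered r P p" "is_segment s"
    "\<bar>fst (fst s) - fst p\<bar> + \<bar>snd (fst s) - snd p\<bar> \<le> r"
    "\<bar>fst (snd s) - fst p\<bar> + \<bar>snd (snd s) - snd p\<bar> \<le> r"
  shows "traverses P (fst s) (snd s)"
proof -
  define x where "x = fst (fst s) - fst p"
  define y where "y = snd (fst s) - snd p"
  define x' where "x' = fst (snd s) - fst p"
  define y' where "y' = snd (snd s) - snd p"
  have s: "fst s = p + (x, y)" "snd s = p + (x', y')"
    by (simp_all add: x_def y_def x'_def y'_def prod_eq_iff)
  have H: "traverses P (p + (u, w)) (p + (u + 1, w))" if "\<bar>u\<bar> + \<bar>w\<bar> \<le> r" "\<bar>u + 1\<bar> + \<bar>w\<bar> \<le> r" for u w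
  proof -
    have "edge_covered P p (True, u, w)" using assms(1) that unfolding diamond_covered_def by blast
    then show ?thesis by simp
  qed
  have V: "traverses P (p + (u, w)) (p + (u, w + 1))" if "\<bar>u\<bar> + \<bar>w\<bar> \<le> r" "\<bar>u\<bar> + \<bar>w + 1\<bar> \<le> r" for u w
  proof -
    have "edge_covered P p (False, u, w)" using assms(1) that unfolding diamond_covered_def by blast
    then show ?thesis by simp
  qed
  have r: "\<bar>x\<bar> + \<bar>y\<bar> \<le> r" "\<bar>x'\<bar> + \<bar>y'\<bar> \<le> r" using assms(3,4) by (simp_all add: x_def y_def x'_def y'_def)
  have "(x' = x + 1 \<and> y' = y) \<or> (x = x' + 1 \<and> y' = y) \<or> (x' = x \<and> y' = y + 1) \<or> (x' = x \<and> y = y' + 1)"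
    using assms(2) by (auto simp: is_segment_def dir_def s)
  then show ?thesis
    unfolding s using H[of x y] H[of x' y'] V[of x y] V[of x' y'] r by (auto simp: traverses_commute)
qed

lemma cball_imp_abs:
  assumes "real_point q \<in> cball (real_point p) r" "2 * r \<le> of_int k"
  shows "\<bar>fst q - fst p\<bar> + \<bar>snd q - snd p\<bar> \<le> k"
proof -
  have d: "dist (real_point p) (real_point q) \<le> r" using assms(1) by simp
  have "dist (fst (real_point p)) (fst (real_point q)) \<le> r" "dist (snd (real_point p)) (snd (real_point q)) \<le> r"
    using dist_fst_le[of "real_point p" "real_point q"] dist_snd_le[of "real_point p" "real_point q"] d by linarith+
  then have "\<bar>real_of_int (fst p) - of_int (fst q)\<bar> + \<bar>real_of_int (snd p) - of_int (snd q)\<bar> \<le> of_int k"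
    using assms(2) by (simp add: real_point_def dist_real_def)
  then have "real_of_int (\<bar>fst p - fst q\<bar> + \<bar>snd p - snd q\<bar>) \<le> of_int k" by simp
  then have "\<bar>fst p - fst q\<bar> + \<bar>snd p - snd q\<bar> \<le> k" by (simp only: of_int_le_iff)
  then show ?thesis by linarith
qed

text \<open>A large disk all of whose edges belong to \<open>D\<close> contains translates of long pieces of \<open>C\<close>
  and \<open>D\<close> by the same vector, and both translates must then be pieces of \<open>D\<close>.\<close>

lemma common_translation:
  assumes cov: "covering \<C>" and lip: "local_isomorphism_property \<C>" and CD: "C \<in> \<C>" "D \<in> \<C>"
  obtains v s t where "\<forall>k. \<bar>k\<bar> \<le> N \<longrightarrow> D (s + k) = shift_segment v (C k)"
    "\<forall>k. \<bar>k\<bar> \<le> N \<longrightarrow> D (t + k) = shift_segment v (D k)"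
proof -
  define dec where "dec X i = (X i, support (X (i - 1)), support (X (i + 1)))"
    for X :: "int \<Rightarrow> segment" and i
  define F where "F = (\<lambda>(X, i). dec X i) ` ({C, D} \<times> {- N..N})"
  have "F \<subseteq> decorated_segments \<C>"
    unfolding F_def dec_def decorated_segments_def using CD by auto
  then have F: "finite F \<and> F \<subseteq> decorated_segments \<C>" unfolding F_def by simp
  from lip[unfolded local_isomorphism_property_def, THEN spec, THEN mp, OF F]
  obtain r where r: "\<forall>z. \<exists>v. translate v ` F \<subseteq> decorated_segments \<C> \<and>
      (\<forall>d\<in>translate v ` F. real_point ` vertices d \<subseteq> cball z r)" by (elim exE conjE)
  \<comment> \<open>A disk of radius \<open>r\<close> lies in the diamond of radius
    \<open>2 * r\<close> with the same centre.\<close>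
  obtain n :: nat where n: "2 * r < 2 ^ n" using real_arch_pow[of 2 "2 * r"] by auto
  note D = covering_curve[OF cov CD(2)]
  obtain p where p: "diamond_covered (2 ^ n + 1) (\<lambda>i. snd (D i)) p"
    using exists_diamond[OF folding_curve_path[OF D]] by blast
  obtain v where v: "translate v ` F \<subseteq> decorated_segments \<C>"
    "\<forall>d\<in>translate v ` F. real_point ` vertices d \<subseteq> cball (real_point p) r"
    using r[THEN spec, of "real_point p"] by (elim exE conjE)
  have piece: "\<exists>s. \<forall>k. \<bar>k\<bar> \<le> N \<longrightarrow> D (s + k) = shift_segment v (X k)" if X: "X \<in> {C, D}" for X
  proof -
    have "\<exists>j. D j = shift_segment v (X k) \<and> support (D (j + 1)) = support (shift_segment v (X (k + 1)))"
      if "\<bar>k\<bar> \<le> N" for k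
    proof -
      have "dec X k \<in> F" unfolding F_def using X that by (auto simp: abs_le_iff)
      then have d: "translate v (dec X k) \<in> translate v ` F" by blast
      then obtain B i where B: "B \<in> \<C>" "translate v (dec X k) = (B i, support (B (i - 1)), support (B (i + 1)))"
        using v(1) unfolding decorated_segments_def by blast
      then have Bi: "B i = shift_segment v (X k)" "support (B (i + 1)) = support (shift_segment v (X (k + 1)))"
        unfolding dec_def translate_eq support_shift_segment by simp_all
      have "real_point ` support (B i) \<subseteq> cball (real_point p) r"
        using v(2) d unfolding B(2) by fastforce
      then have "real_point (fst (B i)) \<in> cball (real_point p) r" "real_point (snd (B i)) \<in> cball (real_point p) r"
        by (auto simp: support_def)
      moreover have "2 * r \<le> of_int (2 ^ n + 1)" using n by simp
      ultimately have "traverses (\<lambda>i. snd (D i)) (fst (B i)) (snd (B i))"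
        using diamond_traverses[OF p folding_curveD(3)[OF covering_curve[OF cov B(1)], of i]] cball_imp_abs by blast
      then obtain j where "{snd (D j), snd (D (j + 1))} = support (B i)"
        unfolding traverses_def support_def by blast
      then have "support (D (j + 1)) = support (B i)"
        using folding_curveD(5)[OF D, of "j + 1"] by (simp add: support_def)
      \<comment> \<open>\<open>D\<close> already uses the support of the translated segment, so the
        unknown curve \<open>B\<close> coincides with \<open>D\<close> up to a shift.\<close>
      from covering_unique[OF cov CD(2) B(1) this] have "B (i + l) = D (j + 1 + l)" for l .
      from this[of 0] this[of 1] Bi show ?thesis by (intro exI[of _ "j + 1"]) simp
    qed
    then obtain f where f: "\<And>k. \<bar>k\<bar> \<le> N \<Longrightarrow> D (f k) = shift_segment v (X k)"
      "\<And>k. \<bar>k\<bar> \<le> N \<Longrightarrow> support (D (f k + 1)) = support (shift_segment v (X (k + 1)))" by metis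
    \<comment> \<open>The decoration carries the support of the next segment, and a support occurs
      only once on \<open>D\<close>; so the separately found segments are consecutive.\<close>
    have step: "f (k + 1) = f k + 1" if "\<bar>k\<bar> \<le> N" "\<bar>k + 1\<bar> \<le> N" for k
    proof -
      have "support (D (f (k + 1))) = support (D (f k + 1))" using f(1)[OF that(2)] f(2)[OF that(1)] by simp
      then show ?thesis using folding_curveD(4)[OF D] by blast
    qed
    have ind: "int m \<le> 2 * N \<longrightarrow> f (- N + int m) = f (- N) + int m" for m
    proof (induction m)
      case (Suc m)
      show ?case
      proof
        assume m: "int (Suc m) \<le> 2 * N"
        then have "f (- N + int m + 1) = f (- N + int m) + 1" by (intro step) auto
        moreover have "f (- N + int m) = f (- N) + int m" using Suc m by auto
        ultimately show "f (- N + int (Suc m)) = f (- N) + int (Suc m)" by (simp add: algebra_simps)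
      qed
    qed simp
    have fk: "f k = f (- N) + (k + N)" if "\<bar>k\<bar> \<le> N" for k
    proof -
      have "int (nat (k + N)) \<le> 2 * N" "- N + int (nat (k + N)) = k" using that by auto
      then show ?thesis using ind[of "nat (k + N)"] by simp
    qed
    have "D (f (- N) + N + k) = shift_segment v (X k)" if "\<bar>k\<bar> \<le> N" for k
    proof -
      have "f (- N) + N + k = f k" using fk[OF that] by simp
      then show ?thesis using f(1)[OF that] by simp
    qed
    then show ?thesis by blast
  qed
  from piece[of C] piece[of D] show ?thesis using that by blast
qed

text \<open>The hypothesis reaches one index further because the turn at \<open>k\<close> reads the
  segments \<open>k\<close> and \<open>k + 1\<close>.\<close>

lemma translated_window:
  assumes "\<And>k. \<bar>k\<bar> \<le> M + 1 \<Longrightarrow> D (s + k) = shift_segment v (C k)" "\<bar>k\<bar> \<le> M"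
  shows "assoc_seq D (s + k) = assoc_seq C k"
proof (rule assoc_seq_shift)
  show "D (s + k) = shift_segment v (C k)" using assms by auto
  show "D (s + k + 1) = shift_segment v (C (k + 1))" using assms(1)[of "k + 1"] assms(2) by (simp add: add.assoc)
qed

text \<open>Some index of \<open>E_seq n\<close> lies in \<open>[0, 2 ^ n)\<close>, well inside the
  window, and its vertex alone fixes the coset.\<close>

lemma translated_E_curve:
  assumes C: "complete_folding_curve C" and D: "complete_folding_curve D"
    and eq: "\<And>k. \<bar>k\<bar> \<le> 2 ^ (n + 4) + 1 \<Longrightarrow> D (s + k) = shift_segment v (C k)"
  shows "y \<in> E_curve n D \<longleftrightarrow> y - v \<in> E_curve n C"
proof -
  obtain x where x: "x \<in> E_seq n (assoc_seq C)" "0 \<le> x" "x < 2 ^ n"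
    using E_seq_ex_small[OF folding_curveD(2)[OF C]] .
  have "(2::int) ^ (n + 4) = 16 * 2 ^ n" by (simp add: power_add)
  then have "\<bar>x\<bar> \<le> 2 ^ (n + 4) + 1" using x by linarith
  then have Dx: "snd (D (s + x)) = v + snd (C x)" using eq snd_shift_segment by simp
  have "s + x \<in> E_seq n (assoc_seq D)"
    using E_seq_window[OF folding_curveD(2)[OF C] folding_curveD(2)[OF D]
      translated_window[of "2 ^ (n + 4)" D s v C, OF eq]] x(1) by blast
  from E_curve_eq[OF D this] E_curve_eq[OF C x(1)] show ?thesis unfolding Dx by (simp add: diff_diff_eq)
qed

lemma local_isomorphism_property_imp:
  assumes cov: "covering \<C>" and lip: "local_isomorphism_property \<C>" and CD: "C \<in> \<C>" "D \<in> \<C>"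
  shows "E_curve n C = E_curve n D" "type_H C \<longleftrightarrow> type_H D"
    "subwords (assoc_seq C) \<subseteq> subwords (assoc_seq D)"
proof -
  note C = covering_curve[OF cov CD(1)] and D = covering_curve[OF cov CD(2)]
  show "E_curve n C = E_curve n D"
  proof -
    obtain v s t where "\<forall>k. \<bar>k\<bar> \<le> 2 ^ (n + 4) + 1 \<longrightarrow> D (s + k) = shift_segment v (C k)"
      "\<forall>k. \<bar>k\<bar> \<le> 2 ^ (n + 4) + 1 \<longrightarrow> D (t + k) = shift_segment v (D k)"
      by (rule common_translation[OF cov lip CD])
    then have "y \<in> E_curve n D \<longleftrightarrow> y - v \<in> E_curve n C" "y \<in> E_curve n D \<longleftrightarrow> y - v \<in> E_curve n D" for y
      using translated_E_curve[OF C D, of n s v y] translated_E_curve[OF D D, of n t v y] by blast+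
    then have "y + v - v \<in> E_curve n C \<longleftrightarrow> y + v - v \<in> E_curve n D" for y by blast
    then show ?thesis by (simp add: set_eq_iff)
  qed
  show "type_H C \<longleftrightarrow> type_H D"
  proof -
    obtain v s t where "\<forall>k. \<bar>k\<bar> \<le> 2 ^ (1 + 4) + 1 \<longrightarrow> D (s + k) = shift_segment v (C k)"
      by (rule common_translation[OF cov lip CD])
    then have eq: "D (s + k) = shift_segment v (C k)" if "\<bar>k\<bar> \<le> 2 ^ (1 + 4) + 1" for k using that by blast
    obtain x where x: "x \<in> E_seq 1 (assoc_seq C)" "0 \<le> x" "x < 2 ^ 1"
      using E_seq_ex_small[OF folding_curveD(2)[OF C]] .
    have "s + x \<in> E_seq 1 (assoc_seq D)"
      using E_seq_window[OF folding_curveD(2)[OF C] folding_curveD(2)[OF D]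
        translated_window[of "2 ^ (1 + 4)" D s v C, OF eq]] x(1) by blast
    moreover have "D (s + x) = shift_segment v (C x)" using eq x by simp
    ultimately show ?thesis using type_iff(1)[OF C x(1)] type_iff(1)[OF D] horizontal_shift by metis
  qed
  show "subwords (assoc_seq C) \<subseteq> subwords (assoc_seq D)"
  proof
    fix w assume "w \<in> subwords (assoc_seq C)"
    then obtain h m where w: "w = map (\<lambda>j. assoc_seq C (h + int j)) [1..<Suc m]"
      unfolding subwords_def by blast
    obtain v s t where "\<forall>k. \<bar>k\<bar> \<le> \<bar>h\<bar> + int m + 1 \<longrightarrow> D (s + k) = shift_segment v (C k)"
      by (rule common_translation[OF cov lip CD])
    then have eq: "D (s + k) = shift_segment v (C k)" if "\<bar>k\<bar> \<le> \<bar>h\<bar> + int m + 1" for k using that by blast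
    have "w = map (\<lambda>j. assoc_seq D (s + h + int j)) [1..<Suc m]"
      unfolding w
    proof (rule map_cong[OF refl])
      fix j assume "j \<in> set [1..<Suc m]"
      then have "\<bar>h + int j\<bar> \<le> \<bar>h\<bar> + int m" by auto
      from translated_window[of "\<bar>h\<bar> + int m" D s v C, OF eq this] show "assoc_seq C (h + int j) = assoc_seq D (s + h + int j)"
        by (simp add: add.assoc)
    qed
    then show "w \<in> subwords (assoc_seq D)" unfolding subwords_def by blast
  qed
qed

subsection \<open>Compatible curves\<close>

text \<open>Indices at distance \<open>2 ^ m\<close> from one of level at least \<open>m + 2\<close>
  have level exactly \<open>m\<close>, where signs alternate with step \<open>2 ^ (m + 1)\<close>.
  So \<open>a (i + 2 ^ m)\<close> is a single sign attached to \<open>a\<close> and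
  \<open>m\<close>, which determines all values at level \<open>m\<close>.\<close>

lemma level_sign:
  assumes a: "complete_folding_seq a" and i: "i \<in> E_seq (Suc (Suc m)) a"
  shows "a (i - 2 ^ m) = - a (i + 2 ^ m)"
    and "j \<in> E_seq (Suc (Suc m)) a \<Longrightarrow> a (j + 2 ^ m) = a (i + 2 ^ m)"
proof -
  have i1: "i \<in> E_seq (Suc m) a" using i E_seq_Suc_subset[OF a] by blast
  then have i0: "i \<in> E_seq m a" using E_seq_Suc_subset[OF a] by blast
  have "i + 2 ^ m \<in> E_seq m a" using E_seq_add[OF a i0, of 1] by simp
  moreover have "i + 2 ^ m \<notin> E_seq (Suc m) a" using E_seq_half(1)[OF a i0] i1 by blast
  ultimately have alt: "a (i + 2 ^ m + k * 2 ^ (m + 1)) = (if even k then a (i + 2 ^ m) else - a (i + 2 ^ m))" for k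
    using E_seq_alternates[OF a] unfolding alternates_at_def by blast
  show "a (i - 2 ^ m) = - a (i + 2 ^ m)" using alt[of "- 1"] by simp
  show "a (j + 2 ^ m) = a (i + 2 ^ m)" if "j \<in> E_seq (Suc (Suc m)) a"
  proof -
    have "2 ^ Suc (Suc m) dvd j - i" using E_seq_iff[OF a i] that by blast
    then obtain k where "j - i = 2 ^ Suc (Suc m) * k" by (rule dvdE)
    then have j: "j + 2 ^ m = i + 2 ^ m + (2 * k) * 2 ^ (m + 1)" by (simp add: algebra_simps)
    show ?thesis unfolding j alt by simp
  qed
qed

lemma subwords_window:
  assumes "subwords a \<subseteq> subwords b"
  obtains t where "\<And>x. \<bar>x\<bar> \<le> M \<Longrightarrow> b (t + x) = a x"
proof -
  define m where "m = nat (2 * M + 1)"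
  define w where "w = map (\<lambda>j. a (- M - 1 + int j)) [1..<Suc m]"
  have "w \<in> subwords a" unfolding w_def subwords_def by blast
  then have "w \<in> subwords b" using assms by blast
  then obtain h k where w: "w = map (\<lambda>j. b (h + int j)) [1..<Suc k]" unfolding subwords_def by blast
  have "length w = m" "length w = k" by (simp add: w_def, simp add: w)
  then have k: "k = m" by simp
  have eq: "a (- M - 1 + int j) = b (h + int j)" if "j \<in> set [1..<Suc m]" for j
    using w[unfolded w_def k] that unfolding map_eq_conv by blast
  have "b (h + M + 1 + x) = a x" if "\<bar>x\<bar> \<le> M" for x
  proof -
    have "nat (x + M + 1) \<in> set [1..<Suc m]" using that unfolding m_def by auto
    from eq[OF this] that show ?thesis by (simp add: algebra_simps)
  qed
  then show ?thesis by (rule that)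
qed

text \<open>A common window long enough to locate \<open>E_seq (Suc (Suc m))\<close> in both
  sequences also contains the place \<open>x + 2 ^ m\<close> where the sign is read.\<close>

lemma locally_isomorphic_level_sign:
  assumes a: "complete_folding_seq a" and b: "complete_folding_seq b" and "subwords a = subwords b"
    and i: "i \<in> E_seq (Suc (Suc m)) a" and j: "j \<in> E_seq (Suc (Suc m)) b"
  shows "b (j + 2 ^ m) = a (i + 2 ^ m)"
proof -
  have sub: "subwords a \<subseteq> subwords b" using assms(3) by simp
  obtain t where t: "\<And>x. \<bar>x\<bar> \<le> 2 ^ (Suc (Suc m) + 4) \<Longrightarrow> b (t + x) = a x"
    using subwords_window[OF sub] by metis
  obtain x where x: "x \<in> E_seq (Suc (Suc m)) a" "0 \<le> x" "x < 2 ^ Suc (Suc m)"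
    by (rule E_seq_ex_small[OF a])
  have "t + x \<in> E_seq (Suc (Suc m)) b" using E_seq_window[OF a b t] x(1) by blast
  then have "b (j + 2 ^ m) = b (t + x + 2 ^ m)" using level_sign(2)[OF b _ j] by blast
  also have "\<dots> = b (t + (x + 2 ^ m))" by (simp add: add.assoc)
  also have "\<dots> = a (x + 2 ^ m)"
  proof (rule t)
    have "(2::int) ^ (Suc (Suc m) + 4) = 64 * 2 ^ m" "(2::int) ^ Suc (Suc m) = 4 * 2 ^ m"
      by (simp_all add: power_add)
    then show "\<bar>x + 2 ^ m\<bar> \<le> 2 ^ (Suc (Suc m) + 4)" using x(2,3) zero_less_power[of "2::int" m] by linarith
  qed
  also have "\<dots> = a (i + 2 ^ m)" using level_sign(2)[OF a i x(1)] .
  finally show ?thesis .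
qed

definition compatible :: "(int \<Rightarrow> segment) \<Rightarrow> (int \<Rightarrow> segment) \<Rightarrow> bool" where
  "compatible C D \<longleftrightarrow> (type_H C \<and> type_H D \<or> type_V C \<and> type_V D) \<and>
     (\<forall>k. E_curve k C = E_curve k D) \<and> subwords (assoc_seq C) = subwords (assoc_seq D)"

lemma compatible_horizontal:
  assumes "complete_folding_curve C" "complete_folding_curve D" "compatible C D"
  shows "horizontal (C i) = horizontal (D j) \<longleftrightarrow>
    (i \<in> E_seq 1 (assoc_seq C) \<longleftrightarrow> j \<in> E_seq 1 (assoc_seq D))"
  using assms(3) horizontal_iff[OF assms(1), of i] horizontal_iff[OF assms(2), of j]
  unfolding compatible_def by blast

lemma same_axis:
  assumes "is_segment s" "is_segment t" "horizontal s \<longleftrightarrow> horizontal t"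
  shows "dir t = dir s \<or> dir t = - dir s"
  using assms by (auto simp: is_segment_def horizontal_def)

lemma add_rot_sign: "q = p \<or> q = - p \<Longrightarrow> q + rot s q = p + rot s p \<or> q + rot s q = - (p + rot s p)"
  by (auto simp: rot_def prod_eq_iff)

text \<open>The type gives the axis of the unit step after an index of \<open>E_seq 1\<close> but
  not its direction, hence the ambiguity of sign. Going up a level multiplies both steps by the same
  \<open>1 + i\<close> or \<open>1 - i\<close>, since the sign of each level is shared.\<close>

lemma compatible_step:
  assumes C: "complete_folding_curve C" and D: "complete_folding_curve D" and CD: "compatible C D"
  shows "i \<in> E_seq (Suc m) (assoc_seq C) \<Longrightarrow> j \<in> E_seq (Suc m) (assoc_seq D) \<Longrightarrow>
    snd (D (j + 2 ^ m)) - snd (D j) = snd (C (i + 2 ^ m)) - snd (C i) \<or>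
    snd (D (j + 2 ^ m)) - snd (D j) = - (snd (C (i + 2 ^ m)) - snd (C i))"
proof (induction m arbitrary: i j)
  case 0
  have "horizontal (C i) \<longleftrightarrow> horizontal (D j)" using compatible_horizontal[OF C D CD, of i j] 0 by simp
  then have "horizontal (C (i + 1)) \<longleftrightarrow> horizontal (D (j + 1))"
    using horizontal_turn(1)[OF C, of i] horizontal_turn(1)[OF D, of j] by blast
  from same_axis[OF folding_curveD(3)[OF C] folding_curveD(3)[OF D] this] show ?case
    using curve_step[OF folding_curveD(1)[OF C], of "i + 1"]
      curve_step[OF folding_curveD(1)[OF D], of "j + 1"] by simp
next
  case (Suc m)
  note a = folding_curveD(2)[OF C] and b = folding_curveD(2)[OF D]
  have ij1: "i \<in> E_seq (Suc m) (assoc_seq C)" "j \<in> E_seq (Suc m) (assoc_seq D)"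
    using Suc.prems E_seq_Suc_subset[OF a] E_seq_Suc_subset[OF b] by blast+
  then have ij: "i \<in> E_seq m (assoc_seq C)" "j \<in> E_seq m (assoc_seq D)"
    using E_seq_Suc_subset[OF a] E_seq_Suc_subset[OF b] by blast+
  have "subwords (assoc_seq C) = subwords (assoc_seq D)" using CD unfolding compatible_def by blast
  from locally_isomorphic_level_sign[OF a b this Suc.prems]
  have s: "assoc_seq D (j + 2 ^ m) = assoc_seq C (i + 2 ^ m)" .
  show ?case
    unfolding coarse_step_split[OF folding_curve_path[OF C] ij(1)]
      coarse_step_split[OF folding_curve_path[OF D] ij(2)] s
    using Suc.IH[OF ij1] by (rule add_rot_sign)
qed

lemma exact_level:
  assumes "complete_folding_seq a" "i \<notin> E_seq n a"
  obtains m where "m < n" "i \<in> E_seq m a" "i \<notin> E_seq (Suc m) a"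
proof -
  have "\<exists>m<n. i \<in> E_seq m a \<and> i \<notin> E_seq (Suc m) a" using assms(2)
  proof (induction n)
    case 0
    then show ?case using E_seq_0[OF assms(1)] by simp
  next
    case (Suc n)
    show ?case
    proof (cases "i \<in> E_seq n a")
      case False
      then show ?thesis using Suc.IH less_Suc_eq by blast
    qed (use Suc.prems in blast)
  qed
  then show ?thesis using that by blast
qed

text \<open>\<open>i - 2 ^ m\<close> and \<open>i + 2 ^ m\<close> are consecutive members of
  \<open>E_seq (Suc m)\<close>, so one of them lies a level higher.\<close>

lemma nearest_upper_level:
  assumes "complete_folding_seq a" "i \<in> E_seq m a" "i \<notin> E_seq (Suc m) a"
  obtains e where "e \<in> E_seq (Suc (Suc m)) a" "i = e + 2 ^ m \<or> i = e - 2 ^ m"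
proof -
  have "i - 2 ^ m \<in> E_seq (Suc m) a" using E_seq_half(2)[OF assms(1,2)] assms(3) by blast
  moreover have "i - 2 ^ m + 2 ^ Suc m = i + 2 ^ m" by simp
  ultimately have "i - 2 ^ m \<in> E_seq (Suc (Suc m)) a \<or> i + 2 ^ m \<in> E_seq (Suc (Suc m)) a"
    using E_seq_half(1)[OF assms(1), of "i - 2 ^ m" "Suc m"] by metis
  then show ?thesis using that[of "i - 2 ^ m"] that[of "i + 2 ^ m"] by auto
qed

lemma rot_inverse: "s = 1 \<or> s = - 1 \<Longrightarrow> rot s p = q \<Longrightarrow> p = rot (- s) q"
  by (auto simp: rot_def prod_eq_iff)

text \<open>Modulo \<open>Lam (m + 2)\<close> the points at distance \<open>2 ^ m\<close> after and before a point of level at least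
  \<open>m + 2\<close> differ from it by \<open>u\<close> and \<open>rot 1 u\<close> for one and the same primitive \<open>u\<close> in
  \<open>Lam m\<close>; so the position of a vertex of level \<open>m\<close> tells which of the two it is.\<close>

lemma opposite_neighbours_incongruent:
  assumes C: "complete_folding_curve C" and D: "complete_folding_curve D" and CD: "compatible C D"
    and e: "e \<in> E_seq (Suc (Suc m)) (assoc_seq C)" "e' \<in> E_seq (Suc (Suc m)) (assoc_seq D)"
  shows "snd (D (e' - 2 ^ m)) - snd (C (e + 2 ^ m)) \<notin> Lam (Suc (Suc m))"
proof
  note a = folding_curveD(2)[OF C] and b = folding_curveD(2)[OF D]
  note pC = folding_curve_path[OF C] and pD = folding_curve_path[OF D]
  assume L: "snd (D (e' - 2 ^ m)) - snd (C (e + 2 ^ m)) \<in> Lam (Suc (Suc m))"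
  have e1: "e \<in> E_seq (Suc m) (assoc_seq C)" "e' \<in> E_seq (Suc m) (assoc_seq D)"
    using e E_seq_Suc_subset[OF a] E_seq_Suc_subset[OF b] by blast+
  then have e0: "e \<in> E_seq m (assoc_seq C)" "e' \<in> E_seq m (assoc_seq D)"
    using E_seq_Suc_subset[OF a] E_seq_Suc_subset[OF b] by blast+
  define u where "u = snd (C (e + 2 ^ m)) - snd (C e)"
  have u: "u \<in> Lam m" "u \<notin> Lam (Suc m)" using coarse_step_Lam[OF pC e0(1)] unfolding u_def by auto
  define w where "w = snd (D e') - snd (D (e' - 2 ^ m))"
  have e'm: "e' - 2 ^ m \<in> E_seq m (assoc_seq D)" using E_seq_add[OF b e0(2), of "- 1"] by simp
  define t where "t = assoc_seq D e'"
  have t: "t = 1 \<or> t = - 1" unfolding t_def by (rule folding_pathD(4)[OF pD])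
  have "rot t w = snd (D (e' + 2 ^ m)) - snd (D e')"
    using coarse_turn[OF pD e'm] by (simp add: w_def t_def algebra_simps)
  then have "rot t w = u \<or> rot t w = - u" using compatible_step[OF C D CD e1] unfolding u_def by simp
  then have "w = rot (- t) u \<or> w = rot (- t) (- u)" using rot_inverse[OF t] by blast
  then have "w = rot 1 u \<or> w = rot (- 1) u" using t by (auto simp: rot_def prod_eq_iff)
  then obtain s where s: "s = 1 \<or> s = - 1" "w = rot s u" by blast
  have "snd (D e') - snd (C e) \<in> Lam (Suc (Suc m))"
  proof -
    have "snd (D e') \<in> E_curve (Suc (Suc m)) D" using E_curve_point_iff[OF D] e(2) by blast
    then have "snd (D e') \<in> E_curve (Suc (Suc m)) C" using CD unfolding compatible_def by simp
    then show ?thesis unfolding E_curve_eq[OF C e(1)] by simp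
  qed
  from Lam_diff[OF this L] have "w + u \<in> Lam (Suc (Suc m))" by (simp add: w_def u_def algebra_simps)
  then have "u + rot s u \<in> Lam (Suc (Suc m))" unfolding s(2) by (simp add: add.commute)
  then show False using Lam_turn[OF s(1)] u(2) by blast
qed

lemma compatible_sym: "compatible C D \<Longrightarrow> compatible D C"
  unfolding compatible_def by auto

text \<open>Congruence modulo \<open>Lam (Suc n)\<close> preserves the level \<open>m < n\<close> of
  a vertex and also whether it comes after or before its neighbour of level at least
  \<open>m + 2\<close>; this side and the sign of level \<open>m\<close> give the turn. With
  \<open>C = D\<close> it is periodicity along one curve.\<close>

lemma compatible_turn:
  assumes C: "complete_folding_curve C" and D: "complete_folding_curve D" and CD: "compatible C D"
    and i: "i \<notin> E_seq n (assoc_seq C)" and L: "snd (D j) - snd (C i) \<in> Lam (Suc n)"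
  shows "assoc_seq D j = assoc_seq C i"
proof -
  note a = folding_curveD(2)[OF C] and b = folding_curveD(2)[OF D]
  obtain m where m: "m < n" "i \<in> E_seq m (assoc_seq C)" "i \<notin> E_seq (Suc m) (assoc_seq C)"
    using exact_level[OF a i] .
  have level: "j \<in> E_seq k (assoc_seq D) \<longleftrightarrow> i \<in> E_seq k (assoc_seq C)" if "k \<le> Suc n" for k
  proof -
    obtain x where x: "x \<in> E_seq k (assoc_seq C)" using E_seq_nonempty[OF a] by blast
    have "snd (D j) - snd (C i) \<in> Lam k" using L Lam_antimono[OF that] by blast
    from Lam_add_iff[OF this, of "snd (C i) - snd (C x)"]
    have "snd (D j) - snd (C x) \<in> Lam k \<longleftrightarrow> snd (C i) - snd (C x) \<in> Lam k" by (simp add: algebra_simps)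
    then have "snd (D j) \<in> E_curve k C \<longleftrightarrow> snd (C i) \<in> E_curve k C" unfolding E_curve_eq[OF C x] by simp
    moreover have "E_curve k C = E_curve k D" using CD unfolding compatible_def by blast
    ultimately show ?thesis using E_curve_point_iff[OF C, of i k] E_curve_point_iff[OF D, of j k] by blast
  qed
  have j: "j \<in> E_seq m (assoc_seq D)" "j \<notin> E_seq (Suc m) (assoc_seq D)"
    using level[of m] level[of "Suc m"] m by auto
  obtain e where e: "e \<in> E_seq (Suc (Suc m)) (assoc_seq C)" "i = e + 2 ^ m \<or> i = e - 2 ^ m"
    using nearest_upper_level[OF a m(2,3)] .
  obtain e' where e': "e' \<in> E_seq (Suc (Suc m)) (assoc_seq D)" "j = e' + 2 ^ m \<or> j = e' - 2 ^ m"
    using nearest_upper_level[OF b j] .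
  \<comment> \<open>Telling the two sides apart takes \<open>Lam (m + 2)\<close>, available because
    \<open>m + 2 \<le> n + 1\<close>.\<close>
  have L2: "snd (D j) - snd (C i) \<in> Lam (Suc (Suc m))" using L Lam_antimono[of "Suc (Suc m)" "Suc n"] m(1) by auto
  have "\<not> (j = e' - 2 ^ m \<and> i = e + 2 ^ m)"
    using opposite_neighbours_incongruent[OF C D CD e(1) e'(1)] L2 by blast
  moreover have "\<not> (i = e - 2 ^ m \<and> j = e' + 2 ^ m)"
    using opposite_neighbours_incongruent[OF D C compatible_sym[OF CD] e'(1) e(1)]
      L2 Lam_minus[of "snd (D j) - snd (C i)"] by auto
  ultimately have ij: "i = e + 2 ^ m \<and> j = e' + 2 ^ m \<or> i = e - 2 ^ m \<and> j = e' - 2 ^ m" using e(2) e'(2) by blast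
  have sub: "subwords (assoc_seq C) = subwords (assoc_seq D)" using CD unfolding compatible_def by blast
  note s = locally_isomorphic_level_sign[OF a b sub e(1) e'(1)]
  show ?thesis using ij s level_sign(1)[OF a e(1)] level_sign(1)[OF b e'(1)] by auto
qed

text \<open>A reversed copy has the same axis, hence the same status with respect to
  \<open>E_seq 1\<close>. But its terminal vertex is the translate of the initial vertex of
  \<open>C i\<close>, whose status is the opposite one.\<close>

lemma compatible_orientation:
  assumes C: "complete_folding_curve C" and D: "complete_folding_curve D" and CD: "compatible C D"
    and v: "v \<in> Lam (Suc 0)" and eq: "support (D j) = support (shift_segment v (C i))"
  shows "D j = shift_segment v (C i)"
proof (rule ccontr)
  note a = folding_curveD(2)[OF C] and b = folding_curveD(2)[OF D]
  assume "D j \<noteq> shift_segment v (C i)"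
  then have rev: "fst (D j) = v + snd (C i)" "snd (D j) = v + fst (C i)"
    using support_eq_cases[OF eq] by (auto simp: fst_shift_segment snd_shift_segment)
  then have "horizontal (D j) \<longleftrightarrow> horizontal (C i)" by (auto simp: horizontal_def dir_def)
  then have E: "i \<in> E_seq 1 (assoc_seq C) \<longleftrightarrow> j \<in> E_seq 1 (assoc_seq D)"
    using compatible_horizontal[OF C D CD] by blast
  obtain x where x: "x \<in> E_seq 1 (assoc_seq C)" using E_seq_nonempty[OF a] by blast
  have "snd (D j) = v + snd (C (i - 1))" using rev folding_curveD(5)[OF C] by simp
  then have d: "snd (D j) - snd (C x) = (snd (C (i - 1)) - snd (C x)) + v" by simp
  have "snd (D j) \<in> E_curve 1 C \<longleftrightarrow> snd (C (i - 1)) \<in> E_curve 1 C"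
    unfolding E_curve_eq[OF C x] mem_Collect_eq d using Lam_add_iff[OF v] by simp
  moreover have "E_curve 1 C = E_curve 1 D" using CD unfolding compatible_def by blast
  ultimately have "j \<in> E_seq 1 (assoc_seq D) \<longleftrightarrow> i - 1 \<in> E_seq 1 (assoc_seq C)"
    using E_curve_point_iff[OF C] E_curve_point_iff[OF D] by simp
  moreover have "i - 1 \<in> E_seq 1 (assoc_seq C) \<longleftrightarrow> i \<notin> E_seq 1 (assoc_seq C)"
    using E_seq_half(2)[OF a, of i 0] E_seq_0[OF a] by simp
  ultimately show False using E by blast
qed

text \<open>Serves the vertices lying in all \<open>E_n\<close>, about which
  \<open>compatible_turn\<close> says nothing. The two strands arrive on one axis; arriving
  oppositely with opposite turns, they would leave along the same edge.\<close>

lemma same_vertex_same_turn: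
  assumes cov: "covering \<C>" and mem: "C \<in> \<C>" "D \<in> \<C>" and CD: "compatible C D"
    and eq: "snd (C i) = snd (D j)"
  shows "assoc_seq D j = assoc_seq C i"
proof -
  note C = covering_curve[OF cov mem(1)] and D = covering_curve[OF cov mem(2)]
  have same: "assoc_seq D j = assoc_seq C i" if "D j = C i"
  proof -
    have "support (C i) = support (D j)" using that by simp
    from covering_unique[OF cov mem this, of 1] that show ?thesis by (simp add: assoc_seq_def)
  qed
  have "E_curve 1 C = E_curve 1 D" using CD unfolding compatible_def by blast
  then have "i \<in> E_seq 1 (assoc_seq C) \<longleftrightarrow> j \<in> E_seq 1 (assoc_seq D)"
    using E_curve_point_iff[OF C] E_curve_point_iff[OF D] eq by metis
  then have "horizontal (C i) \<longleftrightarrow> horizontal (D j)" using compatible_horizontal[OF C D CD] by blast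
  from same_axis[OF folding_curveD(3)[OF C] folding_curveD(3)[OF D] this] show ?thesis
  proof
    assume "dir (D j) = dir (C i)"
    then have "D j = C i" using eq by (auto simp: dir_def prod_eq_iff)
    then show ?thesis by (rule same)
  next
    assume opp: "dir (D j) = - dir (C i)"
    show ?thesis
    proof (rule ccontr)
      assume ne: "assoc_seq D j \<noteq> assoc_seq C i"
      have "assoc_seq D j = - assoc_seq C i"
        using ne complete_folding_values[OF folding_curveD(2)[OF C], of i]
          complete_folding_values[OF folding_curveD(2)[OF D], of j] by auto
      then have "dir (D (j + 1)) = dir (C (i + 1))"
        unfolding folding_curveD(6)[OF C] folding_curveD(6)[OF D] opp by (simp add: rot_def)
      moreover have "fst (D (j + 1)) = fst (C (i + 1))"
        using folding_curveD(5)[OF C, of "i + 1"] folding_curveD(5)[OF D, of "j + 1"] eq by simp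
      ultimately have "D (j + 1) = C (i + 1)" by (intro segment_eqI)
      then have "support (C (i + 1)) = support (D (j + 1))" by simp
      from covering_unique[OF cov mem this, of "- 1"] have "D j = C i" by simp
      then show False using ne same by blast
    qed
  qed
qed


section \<open>Recurrence of finite patterns along a lattice\<close>

definition decorate :: "(int \<Rightarrow> segment) \<times> int \<Rightarrow> decorated" where
  "decorate c = (fst c (snd c), support (fst c (snd c - 1)), support (fst c (snd c + 1)))"

text \<open>\<open>compatible_orientation\<close> fixes the translated segment; the turn at its
  terminal vertex then fixes the successor and the turn at its initial vertex the
  predecessor.\<close>

lemma translate_decorate:
  assumes cov: "covering \<C>" and comp: "\<And>C D. C \<in> \<C> \<Longrightarrow> D \<in> \<C> \<Longrightarrow> compatible C D"
    and mem: "C \<in> \<C>" and v: "v \<in> Lam (Suc 0)"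
    and turn: "\<And>D j. D \<in> \<C> \<Longrightarrow> snd (D j) = v + snd (C i) \<Longrightarrow> assoc_seq D j = assoc_seq C i"
    and turn': "\<And>D j. D \<in> \<C> \<Longrightarrow> snd (D j) = v + snd (C (i - 1)) \<Longrightarrow> assoc_seq D j = assoc_seq C (i - 1)"
  shows "translate v (decorate (C, i)) \<in> decorated_segments \<C>"
proof -
  note C = covering_curve[OF cov mem]
  have "is_segment (shift_segment v (C i))" using folding_curveD(3)[OF C] is_segment_shift by blast
  then obtain D j where D: "D \<in> \<C>" "support (D j) = support (shift_segment v (C i))"
    by (rule covering_edge[OF cov])
  note D' = covering_curve[OF cov D(1)]
  have j: "D j = shift_segment v (C i)"
    using compatible_orientation[OF C D' comp[OF mem D(1)] v D(2)] .
  have j1: "D (j + 1) = shift_segment v (C (i + 1))"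
  proof (rule segment_eqI)
    show "fst (D (j + 1)) = fst (shift_segment v (C (i + 1)))"
      using folding_curveD(5)[OF D', of "j + 1"] folding_curveD(5)[OF C, of "i + 1"] j
      by (simp add: fst_shift_segment snd_shift_segment)
    have "assoc_seq D j = assoc_seq C i" using turn[OF D(1), of j] j by (simp add: snd_shift_segment)
    then show "dir (D (j + 1)) = dir (shift_segment v (C (i + 1)))"
      unfolding dir_shift_segment folding_curveD(6)[OF D'] folding_curveD(6)[OF C] j by simp
  qed
  have j0: "D (j - 1) = shift_segment v (C (i - 1))"
  proof -
    have s: "snd (D (j - 1)) = v + snd (C (i - 1))"
      using folding_curveD(5)[OF D', of j] folding_curveD(5)[OF C, of i] j by (simp add: fst_shift_segment)
    have t: "assoc_seq D (j - 1) = assoc_seq C (i - 1)" using turn'[OF D(1) s] .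
    have "rot (assoc_seq C (i - 1)) (dir (D (j - 1))) = rot (assoc_seq C (i - 1)) (dir (C (i - 1)))"
      using folding_curveD(6)[OF D', of "j - 1"] folding_curveD(6)[OF C, of "i - 1"] j t
      by (simp add: dir_shift_segment)
    then have "dir (D (j - 1)) = dir (C (i - 1))"
      using complete_folding_values[OF folding_curveD(2)[OF C], of "i - 1"] by (auto simp: rot_def prod_eq_iff)
    then show ?thesis using s by (auto simp: dir_def shift_segment_def prod_eq_iff)
  qed
  have "translate v (decorate (C, i)) = (D j, support (D (j - 1)), support (D (j + 1)))"
    unfolding decorate_def fst_conv snd_conv translate_eq j j0 j1 support_shift_segment ..
  then show ?thesis unfolding decorated_segments_def using D(1) by blast
qed

lemma uniform_level:
  assumes "finite K" "\<And>C i. (C, i) \<in> K \<Longrightarrow> complete_folding_seq (assoc_seq C)"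
    "\<And>C i. (C, i) \<in> K \<Longrightarrow> \<exists>n. i \<notin> E_seq n (assoc_seq C)"
  shows "\<exists>n. \<forall>(C, i)\<in>K. i \<notin> E_seq n (assoc_seq C)"
  using assms
proof (induction K rule: finite_induct)
  case (insert c K)
  obtain C i where c: "c = (C, i)" by fastforce
  have "\<exists>n. \<forall>(C, i)\<in>K. i \<notin> E_seq n (assoc_seq C)" using insert.IH insert.prems by blast
  then obtain n where n: "\<And>C i. (C, i) \<in> K \<Longrightarrow> i \<notin> E_seq n (assoc_seq C)" by blast
  obtain m where m: "i \<notin> E_seq m (assoc_seq C)" using insert.prems(2)[of C i] c by blast
  have "j \<notin> E_seq (max m n) (assoc_seq B)" if "(B, j) \<in> insert c K" for B j
  proof -
    have "complete_folding_seq (assoc_seq B)" using insert.prems(1) that by blast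
    from E_seq_antimono[OF this, of m "max m n"] E_seq_antimono[OF this, of n "max m n"]
    show ?thesis using that n[of B j] m c by auto
  qed
  then show ?case by blast
qed simp

text \<open>A vertex of infinite level (there is at most one) is compared with a vertex of large finite
  level on the same curve at which the turn has the same sign.\<close>

lemma periodic_turns:
  assumes cov: "covering \<C>" and comp: "\<And>C D. C \<in> \<C> \<Longrightarrow> D \<in> \<C> \<Longrightarrow> compatible C D"
    and K: "finite K" "K \<subseteq> \<C> \<times> UNIV"
  shows "\<exists>v0 N. \<forall>l\<in>Lam N. v0 + l \<in> Lam (Suc 0) \<and>
    (\<forall>(C, i)\<in>K. \<forall>D\<in>\<C>. \<forall>j. snd (D j) = v0 + l + snd (C i) \<longrightarrow> assoc_seq D j = assoc_seq C i)"
proof -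
  have fold: "complete_folding_curve C" if "C \<in> \<C>" for C using covering_curve[OF cov that] .
  have K1: "C \<in> \<C>" if "(C, i) \<in> K" for C i using K(2) that by blast
  have Kseq: "complete_folding_seq (assoc_seq C)" if "(C, i) \<in> K" for C i
    using folding_curveD(2)[OF fold[OF K1[OF that]]] .
  show ?thesis
  proof (cases "\<exists>C i. (C, i) \<in> K \<and> (\<forall>n. i \<in> E_seq n (assoc_seq C))")
    case False
    then have "\<exists>n. \<forall>(C, i)\<in>K. i \<notin> E_seq n (assoc_seq C)" by (intro uniform_level[OF K(1) Kseq]) blast+
    then obtain n where n: "\<And>C i. (C, i) \<in> K \<Longrightarrow> i \<notin> E_seq n (assoc_seq C)" by blast
    have "0 + l \<in> Lam (Suc 0) \<and>
      (\<forall>(C, i)\<in>K. \<forall>D\<in>\<C>. \<forall>j. snd (D j) = 0 + l + snd (C i) \<longrightarrow> assoc_seq D j = assoc_seq C i)"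
      if l: "l \<in> Lam (Suc n)" for l
    proof (intro conjI ballI allI impI; clarify?)
      show "0 + l \<in> Lam (Suc 0)" using l Lam_antimono[of "Suc 0" "Suc n"] by auto
    next
      fix C i D j assume c: "(C, i) \<in> K" and D: "D \<in> \<C>" and eq: "snd (D j) = 0 + l + snd (C i)"
      have "snd (D j) - snd (C i) \<in> Lam (Suc n)" using eq l by simp
      then show "assoc_seq D j = assoc_seq C i"
        using compatible_turn[OF fold[OF K1[OF c]] fold[OF D] comp[OF K1[OF c] D] n[OF c]] by blast
    qed
    then show ?thesis by blast
  next
    case True
    then obtain B k where B: "(B, k) \<in> K" "\<And>n. k \<in> E_seq n (assoc_seq B)" by blast
    note BC = K1[OF B(1)]
    note b = Kseq[OF B(1)]
    have special: "snd (C i) = snd (B k)" if c: "(C, i) \<in> K" "\<And>n. i \<in> E_seq n (assoc_seq C)" for C i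
    proof -
      have "snd (C i) - snd (B k) \<in> Lam n" for n
      proof -
        have "snd (C i) \<in> E_curve n C" using E_curve_point_iff[OF fold[OF K1[OF c(1)]]] c(2) by blast
        then have "snd (C i) \<in> E_curve n B" using comp[OF K1[OF c(1)] BC] unfolding compatible_def by blast
        then show ?thesis unfolding E_curve_eq[OF fold[OF BC] B(2)] by simp
      qed
      then have "snd (C i) - snd (B k) = 0" by (rule Lam_Inter)
      then show ?thesis by simp
    qed
    define K' where "K' = {(C, i). (C, i) \<in> K \<and> snd (C i) \<noteq> snd (B k)}"
    have "K' \<subseteq> K" unfolding K'_def by blast
    then have "finite K'" using K(1) finite_subset by blast
    moreover have "\<exists>n. i \<notin> E_seq n (assoc_seq C)" if "(C, i) \<in> K'" for C i
      using special[of C i] that unfolding K'_def by blast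
    ultimately have "\<exists>n. \<forall>(C, i)\<in>K'. i \<notin> E_seq n (assoc_seq C)"
      using Kseq \<open>K' \<subseteq> K\<close> by (intro uniform_level) blast+
    then obtain n where n: "\<And>C i. (C, i) \<in> K' \<Longrightarrow> i \<notin> E_seq n (assoc_seq C)" by blast
    \<comment> \<open>The two indices at distance \<open>2 ^ (n + 1)\<close> from \<open>k\<close>
      have level exactly \<open>n + 1\<close> and opposite turns, so one of them turns as
      \<open>k\<close> does.\<close>
    have "assoc_seq B (k - 2 ^ Suc n) = - assoc_seq B (k + 2 ^ Suc n)" using level_sign(1)[OF b B(2)] .
    then have "assoc_seq B (k + 2 ^ Suc n) = assoc_seq B k \<or> assoc_seq B (k - 2 ^ Suc n) = assoc_seq B k"
      using complete_folding_values[OF b, of k] complete_folding_values[OF b, of "k + 2 ^ Suc n"] by auto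
    moreover have "k + 2 ^ Suc n \<in> E_seq (Suc n) (assoc_seq B)" "k - 2 ^ Suc n \<in> E_seq (Suc n) (assoc_seq B)"
      using E_seq_add[OF b B(2), of 1 "Suc n"] E_seq_add[OF b B(2), of "- 1" "Suc n"] by simp_all
    moreover have "k + 2 ^ Suc n \<notin> E_seq (Suc (Suc n)) (assoc_seq B)"
      "k - 2 ^ Suc n \<notin> E_seq (Suc (Suc n)) (assoc_seq B)"
      using E_seq_half[OF b B(2)] B(2) by blast+
    ultimately obtain k' where k': "assoc_seq B k' = assoc_seq B k" "k' \<in> E_seq (Suc n) (assoc_seq B)"
      "k' \<notin> E_seq (Suc (Suc n)) (assoc_seq B)" by blast
    define v0 where "v0 = snd (B k') - snd (B k)"
    have v0: "v0 \<in> Lam (Suc n)"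
      using E_seq_point_iff[OF folding_curve_path[OF fold[OF BC]] B(2)] k'(2) unfolding v0_def by blast
    \<comment> \<open>\<open>k'\<close> is outside \<open>E_seq (n + 2)\<close>, so a comparison
      with it takes \<open>l\<close> in \<open>Lam (n + 3)\<close>. Vertices other than that of
      \<open>k\<close> are outside \<open>E_seq n\<close> and tolerate any vector of
      \<open>Lam (n + 1)\<close>, such as \<open>v0 + l\<close>.\<close>
    have "v0 + l \<in> Lam (Suc 0) \<and>
      (\<forall>(C, i)\<in>K. \<forall>D\<in>\<C>. \<forall>j. snd (D j) = v0 + l + snd (C i) \<longrightarrow> assoc_seq D j = assoc_seq C i)"
      if l: "l \<in> Lam (Suc (Suc (Suc n)))" for l
    proof -
      have "l \<in> Lam (Suc n)" using l Lam_antimono[of "Suc n" "Suc (Suc (Suc n))"] by auto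
      then have v: "v0 + l \<in> Lam (Suc n)" using Lam_add[OF v0] by blast
      have "assoc_seq D j = assoc_seq C i"
        if c: "(C, i) \<in> K" and D: "D \<in> \<C>" and eq: "snd (D j) = v0 + l + snd (C i)" for C i D j
      proof (cases "snd (C i) = snd (B k)")
        case True
        have "snd (D j) - snd (B k') = l" unfolding eq True v0_def by simp
        then have "snd (D j) - snd (B k') \<in> Lam (Suc (Suc (Suc n)))" using l by simp
        from compatible_turn[OF fold[OF BC] fold[OF D] comp[OF BC D] k'(3) this] k'(1)
        have "assoc_seq D j = assoc_seq B k" by simp
        also have "\<dots> = assoc_seq C i"
          using same_vertex_same_turn[OF cov K1[OF c] BC comp[OF K1[OF c] BC] True] .
        finally show ?thesis .
      next
        case False
        then have "i \<notin> E_seq n (assoc_seq C)" using n[of C i] c unfolding K'_def by blast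
        moreover have "snd (D j) - snd (C i) \<in> Lam (Suc n)" using v unfolding eq by simp
        ultimately show ?thesis
          using compatible_turn[OF fold[OF K1[OF c]] fold[OF D] comp[OF K1[OF c] D]] by blast
      qed
      moreover have "v0 + l \<in> Lam (Suc 0)" using v Lam_antimono[of "Suc 0" "Suc n"] by auto
      ultimately show ?thesis by blast
    qed
    then show ?thesis by blast
  qed
qed

lemma vertices_translate: "vertices (translate v d) = (+) v ` vertices d"
proof -
  obtain s e f where d: "d = (s, e, f)" by (cases d) auto
  show ?thesis unfolding d translate_eq vertices.simps support_shift_segment by (simp add: image_Un)
qed

lemma real_point_add: "real_point (p + q) = real_point p + real_point q"
  by (simp add: real_point_def)

text \<open>Rounding down to multiples of \<open>2 ^ N\<close>, which form a sublattice of
  \<open>Lam N\<close>, costs at most \<open>2 ^ N\<close> per coordinate.\<close>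

lemma lattice_point_near:
  fixes z :: "real \<times> real"
  shows "\<exists>l\<in>Lam N. dist z (real_point l) \<le> 2 * 2 ^ N"
proof -
  define x where "x = \<lfloor>fst z / 2 ^ N\<rfloor>"
  define y where "y = \<lfloor>snd z / 2 ^ N\<rfloor>"
  let ?l = "(2 ^ N * x, 2 ^ N * y)"
  have near: "\<bar>t - 2 ^ N * real_of_int \<lfloor>t / 2 ^ N\<rfloor>\<bar> \<le> 2 ^ N" for t :: real
  proof -
    define q where "q = t / 2 ^ N"
    have "real_of_int \<lfloor>q\<rfloor> * 2 ^ N \<le> q * 2 ^ N" by (intro mult_right_mono) simp_all
    moreover have "q * 2 ^ N \<le> (real_of_int \<lfloor>q\<rfloor> + 1) * 2 ^ N" by (intro mult_right_mono) (linarith, simp)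
    moreover have "q * 2 ^ N = t" by (simp add: q_def)
    ultimately show ?thesis unfolding q_def[symmetric] by (simp add: algebra_simps abs_le_iff)
  qed
  have "dist z (real_point ?l) \<le> dist (fst z) (fst (real_point ?l)) + dist (snd z) (snd (real_point ?l))"
    unfolding dist_prod_def by (rule sqrt_sum_squares_le_sum) auto
  also have "\<dots> \<le> 2 ^ N + 2 ^ N"
    using near[of "fst z"] near[of "snd z"] by (intro add_mono) (simp_all add: real_point_def dist_real_def x_def y_def)
  finally show ?thesis using scaled_in_Lam[of N x y] by (intro bexI[of _ ?l]) simp_all
qed

lemma compatible_imp_local_isomorphism_property:
  assumes cov: "covering \<C>" and comp: "\<And>C D. C \<in> \<C> \<Longrightarrow> D \<in> \<C> \<Longrightarrow> compatible C D"
  shows "local_isomorphism_property \<C>"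
  unfolding local_isomorphism_property_def
proof (intro allI impI)
  fix F assume F: "finite F \<and> F \<subseteq> decorated_segments \<C>"
  have "decorated_segments \<C> = decorate ` (\<C> \<times> UNIV)"
  proof (intro set_eqI iffI)
    fix d assume "d \<in> decorated_segments \<C>"
    then obtain C i where "C \<in> \<C>" "d = decorate (C, i)" unfolding decorated_segments_def decorate_def by auto
    then show "d \<in> decorate ` (\<C> \<times> UNIV)" by blast
  next
    fix d assume "d \<in> decorate ` (\<C> \<times> UNIV)"
    then obtain C i where "C \<in> \<C>" "d = decorate (C, i)" by auto
    then show "d \<in> decorated_segments \<C>" unfolding decorated_segments_def decorate_def by auto
  qed
  then obtain I where I: "I \<subseteq> \<C> \<times> UNIV" "finite I" "F = decorate ` I"
    using F finite_subset_image[of F decorate "\<C> \<times> UNIV"] by auto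
  \<comment> \<open>The initial vertex of segment \<open>i\<close> carries the index
    \<open>i - 1\<close>; its turn decides the predecessor.\<close>
  define K where "K = I \<union> (\<lambda>(C, i). (C, i - 1)) ` I"
  have "finite K" "K \<subseteq> \<C> \<times> UNIV" unfolding K_def using I by auto
  from periodic_turns[OF cov comp this] obtain v0 N where v0: "\<And>l. l \<in> Lam N \<Longrightarrow> v0 + l \<in> Lam (Suc 0) \<and>
    (\<forall>(C, i)\<in>K. \<forall>D\<in>\<C>. \<forall>j. snd (D j) = v0 + l + snd (C i) \<longrightarrow> assoc_seq D j = assoc_seq C i)"
    by blast
  have "finite (vertices d)" if "d \<in> F" for d
    using that unfolding I(3) by (auto simp: decorate_def support_def)
  then have "finite (real_point ` (\<Union>d\<in>F. vertices d))" using F by blast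
  then obtain R where R: "\<And>x. x \<in> real_point ` (\<Union>d\<in>F. vertices d) \<Longrightarrow> norm x \<le> R"
    using finite_imp_bounded bounded_iff by metis
  \<comment> \<open>The summands bound the distance from \<open>z\<close> to the lattice point, the
    fixed vector \<open>v0\<close> and the size of the pattern. \<open>\<bar>R\<bar>\<close> guards
    against a negative \<open>R\<close>, possible when \<open>F\<close> is empty.\<close>
  define r where "r = 2 * 2 ^ N + norm (real_point v0) + \<bar>R\<bar>"
  have "0 < r" unfolding r_def by (intro add_pos_nonneg) auto
  moreover have "\<exists>v. translate v ` F \<subseteq> decorated_segments \<C> \<and>
      (\<forall>d\<in>translate v ` F. real_point ` vertices d \<subseteq> cball z r)" for z
  proof -
    obtain l where l: "l \<in> Lam N" "dist z (real_point l) \<le> 2 * 2 ^ N" using lattice_point_near by blast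
    have "translate (v0 + l) d \<in> decorated_segments \<C>" if "d \<in> F" for d
    proof -
      obtain C i where C: "(C, i) \<in> I" "d = decorate (C, i)" using \<open>d \<in> F\<close> unfolding I(3) by auto
      then have K: "(C, i) \<in> K" "(C, i - 1) \<in> K" unfolding K_def by force+
      have "C \<in> \<C>" using C(1) I(1) by blast
      then show ?thesis unfolding C(2) using v0[OF l(1)] K
        by (intro translate_decorate[OF cov comp]) blast+
    qed
    moreover have "real_point ` vertices d \<subseteq> cball z r" if d: "d \<in> translate (v0 + l) ` F" for d
    proof
      fix x assume "x \<in> real_point ` vertices d"
      moreover obtain c where c: "c \<in> F" "d = translate (v0 + l) c" using d by blast
      ultimately obtain q where q: "q \<in> vertices c" "x = real_point (v0 + l + q)"
        unfolding c(2) vertices_translate by blast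
      have "norm (real_point q) \<le> \<bar>R\<bar>" using R[of "real_point q"] c(1) q(1) by fastforce
      moreover have "dist z x \<le> dist z (real_point l) + norm (real_point v0 + real_point q)"
        unfolding q(2) real_point_add dist_norm
        using norm_triangle_ineq4[of "z - real_point l" "real_point v0 + real_point q"]
        by (simp add: algebra_simps)
      moreover have "norm (real_point v0 + real_point q) \<le> norm (real_point v0) + norm (real_point q)"
        by (rule norm_triangle_ineq)
      ultimately show "x \<in> cball z r" using l(2) unfolding r_def by simp
    qed
    ultimately show ?thesis by blast
  qed
  ultimately show "\<exists>r>0. \<forall>z. \<exists>v. translate v ` F \<subseteq> decorated_segments \<C> \<and>
      (\<forall>d\<in>translate v ` F. real_point ` vertices d \<subseteq> cball z r)" by blast
qed

theorem theorem3p5: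
  fixes \<C> :: "(int \<Rightarrow> segment) set"
  assumes "covering \<C>"
  shows "local_isomorphism_property \<C> \<longleftrightarrow>
    ((\<forall>C\<in>\<C>. type_H C) \<or> (\<forall>C\<in>\<C>. type_V C)) \<and>
    (\<forall>C\<in>\<C>. \<forall>D\<in>\<C>. \<forall>k. E_curve k C = E_curve k D) \<and>
    (\<forall>C\<in>\<C>. \<forall>D\<in>\<C>. locally_isomorphic (assoc_seq C) (assoc_seq D))"
  (is "?lip \<longleftrightarrow> ?types \<and> ?E \<and> ?loc")
proof
  assume lip: ?lip
  note imp = local_isomorphism_property_imp[OF assms lip]
  \<comment> \<open>Only \<open>type_H\<close> is transferred between curves. Failing it means type
    V, since the segments with index in \<open>E_seq 1\<close> lie an even number of turns apart and
    share their axis.\<close>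
  have types: "type_H C \<or> type_V C" if "C \<in> \<C>" for C
  proof -
    note C = covering_curve[OF assms that]
    obtain i where "i \<in> E_seq 1 (assoc_seq C)" using E_seq_nonempty[OF folding_curveD(2)[OF C]] by blast
    then show ?thesis using type_iff[OF C] by blast
  qed
  have ?types
  proof (cases "\<exists>C\<in>\<C>. type_H C")
    case True
    then show ?thesis using imp(2) by blast
  next
    case False
    then show ?thesis using types by blast
  qed
  moreover have ?E using imp(1) by blast
  moreover have ?loc using imp(3) unfolding locally_isomorphic_def by blast
  ultimately show "?types \<and> ?E \<and> ?loc" by blast
next
  assume "?types \<and> ?E \<and> ?loc"
  then have "compatible C D" if "C \<in> \<C>" "D \<in> \<C>" for C D
    using that unfolding compatible_def locally_isomorphic_def by blast
  then show ?lip by (rule compatible_imp_local_isomorphism_property[OF assms])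
qed

end
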